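(* Fix $n\ge2$ and consider the partition $\theta=(2,1,1,\dots,1,0)$ with $n-1$ nonzero parts and $|\theta|=n$. For $k\ge0$, let $\mathcal C_k$ denote the set of column strict fillings $F$ of shape $k\theta$ with entries in $[n]$, with the property that either $1$ occurs in the first column of $F$ or $1$ does not occur in its last column. Then $$\chi_{\Lambda_0}=\sum_{k\ge0}\ \sum_{F\in\mathcal C_k}\overline{x}^{\,F}\,q^{k^2-\mathrm{inv}(F)}.$$
   Context: For $\gamma=(c_1,\dots,c_n)\in\mathbb Z^n$, $|\gamma|=\sum c_i$, $\lVert\gamma\rVert^2=\sum_{i=1}^nc_i^2-|\gamma|^2/n$ and $x^\gamma=\prod x_i^{c_i}$. $$\chi_{\Lambda_0}:=\frac{\Theta(X_n,q)}{\prod_{k\ge1}(1-q^k)^{n-1}},\qquad\Theta(X_n,q)=\sum_{\gamma\in\mathbb Z^n,\,|\gamma|=0}q^{\lVert\gamma\rVert^2/2}x^\gamma;$$ this is the (normalized) character of the basic representation $L(\Lambda_0)$ of the affine Lie algebra $\widehat{\mathfrak{sl}_n}$. Identities are between formal power series in $q$ with Laurent polynomial coefficients in $x_1,\dots,x_n$. For a partition $\mu$, $\mathrm{dg}(\mu)=\{(r,c):1\le c\le\mu_r\}$ ($r$ = row from the top, $c$ = column from the left); a column strict filling of shape $\mu$ is a map $F:\mathrm{dg}(\mu)\to[n]=\{1,\dots,n\}$ strictly increasing down each column. $x^F=\prod_{c\in\mathrm{dg}(\mu)}x_{F(c)}$ and, for $n$ dividing $|\mu|$, $\overline{x}^{\,F}=x^F(x_1x_2\cdots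 x_n)^{-|\mu|/n}$. For $k=0$ the shape is empty and $\mathcal C_0$ consists of the single empty filling. For a cell $u=(i,j)$ with $i>1$ let $u^\uparrow=(i-1,j)$; $\mathrm{Des}(F)$ is the set of cells $u$ not in the first row with $F(u)>F(u^\uparrow)$; $\mathrm{arm}(u)$ is the number of cells strictly to the right of $u$ in its row. A cell $u$ Inv-attacks $v$ if they are in the same row with $u$ strictly left of $v$, or $u$ is in the row immediately below that of $v$, in a column strictly to the right of that of $v$. $\mathrm{Inv}(F)$ is the set of pairs $(u,v)$ such that $u$ Inv-attacks $v$ and $F(u)>F(v)$; $\mathrm{inv}(F)=|\mathrm{Inv}(F)|-\sum_{u\in\mathrm{Des}(F)}\mathrm{arm}(u)$. *)

theory Defs
  imports
    "HOL-Analysis.Infinite_Products"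
    "HOL-Computational_Algebra.Formal_Laurent_Series"
    "HOL-Library.FuncSet"
    "HOL-Library.Poly_Mapping"
begin

text \<open>
  Laurent polynomials over the integers are elements of the group ring of the exponent lattice.
  An exponent vector in \<open>\<int>\<^sup>n\<close> is a finitely supported map with support in \<open>{1..n}\<close>.
\<close>

type_synonym expvec = "nat \<Rightarrow>\<^sub>0 int"
type_synonym laurent_poly = "expvec \<Rightarrow>\<^sub>0 int"

definition exp_lattice :: "nat \<Rightarrow> expvec set" where
  "exp_lattice n = {\<gamma>. Poly_Mapping.keys \<gamma> \<subseteq> {1..n}}"

definition coord_sum :: "nat \<Rightarrow> expvec \<Rightarrow> int" where
  "coord_sum n \<gamma> = (\<Sum>i=1..n. Poly_Mapping.lookup \<gamma> i)"

definition norm_sq :: "nat \<Rightarrow> expvec \<Rightarrow> real" where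
  "norm_sq n \<gamma> = (\<Sum>i=1..n. (of_int (Poly_Mapping.lookup \<gamma> i))\<^sup>2) - (of_int (coord_sum n \<gamma>))\<^sup>2 / real n"

definition x_pow :: "expvec \<Rightarrow> laurent_poly" where
  "x_pow \<gamma> = Poly_Mapping.single \<gamma> 1"

definition x_var :: "nat \<Rightarrow> laurent_poly" where
  "x_var i = x_pow (Poly_Mapping.single i 1)"


text \<open>
  \<open>\<Theta>\<close> is given by its coefficients. By \<open>finite_Theta_support\<close> and \<open>norm_sq_half_nat\<close> below, every
  coefficient is a finite sum and every \<open>\<gamma>\<close> with \<open>coord_sum n \<gamma> = 0\<close> contributes to exactly one
  coefficient.
\<close>

definition Theta :: "nat \<Rightarrow> laurent_poly fps" where
  "Theta n = Abs_fps (\<lambda>m. \<Sum>\<gamma> | \<gamma> \<in> exp_lattice n \<and> coord_sum n \<gamma> = 0 \<and> norm_sq n \<gamma> / 2 = real m. x_pow \<gamma>)"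

text \<open>
  The infinite product is taken in the \<open>q\<close>-adic topology of \<^typ>\<open>laurent_poly fps\<close>, and starts at
  index \<open>0\<close>; it converges by \<open>euler_denom_has_prod\<close> below.
\<close>

definition euler_denom :: "nat \<Rightarrow> laurent_poly fps" where
  "euler_denom n = prodinf (\<lambda>k. (1 - fps_X ^ Suc k) ^ (n - 1))"

text \<open>
  Laurent polynomials do not form a field, so division of power series is multiplication by the
  inverse series of \<open>euler_denom n\<close>, whose constant coefficient is \<open>1\<close>.
\<close>

definition chi :: "nat \<Rightarrow> laurent_poly fps" where
  "chi n = Theta n * fps_right_inverse (euler_denom n) 1"


text \<open>
  A partition is the list of its parts in weakly decreasing order, possibly with trailing zeros.
  Cells are pairs (row, column), both counted from \<open>1\<close>. Fillings are extensional functions,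
  so that distinct fillings of a shape differ on its diagram.
\<close>

definition dg :: "nat list \<Rightarrow> (nat \<times> nat) set" where
  "dg \<mu> = {(r, c). 1 \<le> r \<and> r \<le> length \<mu> \<and> 1 \<le> c \<and> c \<le> \<mu> ! (r - 1)}"

definition col_strict_fillings :: "nat \<Rightarrow> nat list \<Rightarrow> (nat \<times> nat \<Rightarrow> nat) set" where
  "col_strict_fillings n \<mu> =
     {F \<in> dg \<mu> \<rightarrow>\<^sub>E {1..n}.
        \<forall>r r' c. (r, c) \<in> dg \<mu> \<longrightarrow> (r', c) \<in> dg \<mu> \<longrightarrow> r < r' \<longrightarrow> F (r, c) < F (r', c)}"

definition x_filling :: "nat list \<Rightarrow> (nat \<times> nat \<Rightarrow> nat) \<Rightarrow> laurent_poly" where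
  "x_filling \<mu> F = (\<Prod>u\<in>dg \<mu>. x_var (F u))"

text \<open>Meaningful only if \<open>n\<close> divides \<open>sum_list \<mu>\<close>, the size of the partition.\<close>

definition x_bar :: "nat \<Rightarrow> nat list \<Rightarrow> (nat \<times> nat \<Rightarrow> nat) \<Rightarrow> laurent_poly" where
  "x_bar n \<mu> F =
     x_filling \<mu> F * x_pow (\<Sum>i=1..n. Poly_Mapping.single i (- int (sum_list \<mu> div n)))"

definition Des :: "nat list \<Rightarrow> (nat \<times> nat \<Rightarrow> nat) \<Rightarrow> (nat \<times> nat) set" where
  "Des \<mu> F = {(i, j). (i, j) \<in> dg \<mu> \<and> i > 1 \<and> F (i, j) > F (i - 1, j)}"

definition arm :: "nat list \<Rightarrow> nat \<times> nat \<Rightarrow> nat" where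
  "arm \<mu> u = card {c. (fst u, c) \<in> dg \<mu> \<and> c > snd u}"

definition Inv_attacks :: "nat \<times> nat \<Rightarrow> nat \<times> nat \<Rightarrow> bool" where
  "Inv_attacks u v \<longleftrightarrow>
     fst u = fst v \<and> snd u < snd v \<or> fst u = fst v + 1 \<and> snd u > snd v"

definition Inv_set :: "nat list \<Rightarrow> (nat \<times> nat \<Rightarrow> nat) \<Rightarrow> ((nat \<times> nat) \<times> (nat \<times> nat)) set" where
  "Inv_set \<mu> F = {(u, v). u \<in> dg \<mu> \<and> v \<in> dg \<mu> \<and> Inv_attacks u v \<and> F u > F v}"

definition inv_stat :: "nat list \<Rightarrow> (nat \<times> nat \<Rightarrow> nat) \<Rightarrow> int" where
  "inv_stat \<mu> F = int (card (Inv_set \<mu> F)) - (\<Sum>u\<in>Des \<mu> F. int (arm \<mu> u))"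

definition theta :: "nat \<Rightarrow> nat list" where
  "theta n = 2 # replicate (n - 2) 1 @ [0]"

definition k_theta :: "nat \<Rightarrow> nat \<Rightarrow> nat list" where
  "k_theta n k = map (\<lambda>p. k * p) (theta n)"

definition occurs_in_column :: "nat list \<Rightarrow> (nat \<times> nat \<Rightarrow> nat) \<Rightarrow> nat \<Rightarrow> nat \<Rightarrow> bool" where
  "occurs_in_column \<mu> F a c \<longleftrightarrow> (\<exists>r. (r, c) \<in> dg \<mu> \<and> F (r, c) = a)"

text \<open>The last column has index \<open>hd (k_theta n k) = 2 * k\<close>, the largest part.\<close>

definition C_fillings :: "nat \<Rightarrow> nat \<Rightarrow> (nat \<times> nat \<Rightarrow> nat) set" where
  "C_fillings n k =
     {F \<in> col_strict_fillings n (k_theta n k).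
        occurs_in_column (k_theta n k) F 1 1 \<or>
        \<not> occurs_in_column (k_theta n k) F 1 (hd (k_theta n k))}"

text \<open>
  The exponent of \<open>q\<close> attached to a filling is an integer expression, so it is best used with
  \<open>fls_X_intpow\<close> in formal Laurent series in \<open>q\<close>, into which power series embed by
  \<^const>\<open>fps_to_fls\<close>; no exponent is truncated to a natural number.
\<close>

lemma norm_sq_half_nat:
  assumes "coord_sum n \<gamma> = 0"
  shows "\<exists>!m. norm_sq n \<gamma> / 2 = real m"
proof -
  have "even (\<Sum>i=1..n. (Poly_Mapping.lookup \<gamma> i)\<^sup>2 + Poly_Mapping.lookup \<gamma> i)"
    by (intro dvd_sum) (simp add: power2_eq_square)
  hence "even (\<Sum>i=1..n. (Poly_Mapping.lookup \<gamma> i)\<^sup>2)"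
    using assms by (simp add: sum.distrib coord_sum_def)
  then obtain z where z: "(\<Sum>i=1..n. (Poly_Mapping.lookup \<gamma> i)\<^sup>2) = 2 * z" by blast
  have "(\<Sum>i=1..n. (Poly_Mapping.lookup \<gamma> i)\<^sup>2) \<ge> 0" by (intro sum_nonneg) simp
  hence "z \<ge> 0" using z by simp
  have "norm_sq n \<gamma> = of_int (\<Sum>i=1..n. (Poly_Mapping.lookup \<gamma> i)\<^sup>2)"
    using assms by (simp add: norm_sq_def)
  hence "norm_sq n \<gamma> / 2 = real (nat z)" using \<open>z \<ge> 0\<close> unfolding z by simp
  thus ?thesis by auto
qed

lemma finite_Theta_support:
  "finite {\<gamma>. \<gamma> \<in> exp_lattice n \<and> coord_sum n \<gamma> = 0 \<and> norm_sq n \<gamma> / 2 = real m}" (is "finite ?S")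
proof (rule finite_imageD)
  let ?R = "\<lambda>\<gamma>::expvec. restrict (Poly_Mapping.lookup \<gamma>) {1..n}"
  have "?R ` ?S \<subseteq> {1..n} \<rightarrow>\<^sub>E {- int (2*m)..int (2*m)}"
  proof
    fix g assume "g \<in> ?R ` ?S"
    then obtain \<gamma> where g: "g = ?R \<gamma>" and \<gamma>: "coord_sum n \<gamma> = 0" "norm_sq n \<gamma> / 2 = real m" by auto
    have "real_of_int (\<Sum>i=1..n. (Poly_Mapping.lookup \<gamma> i)\<^sup>2) = real_of_int (int (2*m))"
      using \<gamma> by (simp add: norm_sq_def)
    hence s: "(\<Sum>i=1..n. (Poly_Mapping.lookup \<gamma> i)\<^sup>2) = int (2*m)" by (simp only: of_int_eq_iff)
    have "\<bar>Poly_Mapping.lookup \<gamma> i\<bar> \<le> int (2*m)" if "i \<in> {1..n}" for i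
    proof -
      have "(Poly_Mapping.lookup \<gamma> i)\<^sup>2 \<le> (\<Sum>i=1..n. (Poly_Mapping.lookup \<gamma> i)\<^sup>2)"
        by (rule member_le_sum) (use that in auto)
      moreover have "\<bar>Poly_Mapping.lookup \<gamma> i\<bar> \<le> (Poly_Mapping.lookup \<gamma> i)\<^sup>2"
        using self_le_power[of "\<bar>Poly_Mapping.lookup \<gamma> i\<bar>" 2] by (cases "Poly_Mapping.lookup \<gamma> i = 0") auto
      ultimately show ?thesis using s by linarith
    qed
    thus "g \<in> {1..n} \<rightarrow>\<^sub>E {- int (2*m)..int (2*m)}"
      unfolding g by (intro restrict_PiE_iff[THEN iffD2]) (force simp: abs_le_iff)
  qed
  thus "finite (?R ` ?S)" by (rule finite_subset) (intro finite_PiE; simp)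
  show "inj_on ?R ?S"
  proof (rule inj_onI, rule poly_mapping_eqI)
    fix a b i assume "a \<in> ?S" "b \<in> ?S" "?R a = ?R b"
    hence "i \<notin> {1..n} \<Longrightarrow> Poly_Mapping.lookup a i = 0 \<and> Poly_Mapping.lookup b i = 0"
      and "?R a i = ?R b i"
      by (auto simp: exp_lattice_def subset_iff Poly_Mapping.in_keys_iff)
    thus "Poly_Mapping.lookup a i = Poly_Mapping.lookup b i"
      by (cases "i \<in> {1..n}") auto
  qed
qed

lemma euler_denom_has_prod:
  "(\<lambda>k. (1 - fps_X ^ Suc k) ^ (n - 1)) has_prod euler_denom n" (is ?A)
  "fps_nth (euler_denom n) 0 = 1" (is ?B)
proof -
  let ?f = "\<lambda>k. (1 - fps_X ^ Suc k) ^ (n - 1) :: laurent_poly fps"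
  define P where "P = (\<lambda>N. \<Prod>k\<le>N. ?f k)"
  define p where "p = Abs_fps (\<lambda>m. fps_nth (P m) m)"
  have f0: "fps_nth (?f k) j = (if j = 0 then 1 else 0)" if "j \<le> k" for k j
  proof -
    have "fps_nth ((1 - fps_X ^ Suc k) ^ e :: laurent_poly fps) i = (if i = 0 then 1 else 0)"
      if "i \<le> k" for e i
      using that
    proof (induction e arbitrary: i)
      case (Suc e)
      have "(1 - fps_X ^ Suc k) ^ Suc e =
            (1 - fps_X ^ Suc k) ^ e - fps_X ^ Suc k * ((1 - fps_X ^ Suc k) ^ e :: laurent_poly fps)"
        by (simp add: algebra_simps)
      thus ?case using Suc by (simp only: fps_sub_nth fps_X_power_mult_nth) simp
    qed simp
    thus ?thesis using that by blast
  qed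
  have step: "fps_nth (P (Suc N)) m = fps_nth (P N) m" if "m \<le> N" for N m
  proof -
    have "fps_nth (P (Suc N)) m = fps_nth (P N * ?f (Suc N)) m" by (simp add: P_def)
    also have "\<dots> = (\<Sum>i=0..m. fps_nth (P N) i * (if m - i = 0 then 1 else 0))"
      unfolding fps_mult_nth by (rule sum.cong[OF refl], subst f0) (use that in auto)
    also have "\<dots> = (\<Sum>i\<in>{m}. fps_nth (P N) i)"
      by (rule sum.mono_neutral_cong_right) auto
    finally show ?thesis by simp
  qed
  have stable: "fps_nth (P N) m = fps_nth p m" if "m \<le> N" for N m
    using that by (induction N rule: dec_induct) (auto simp: p_def step)
  have p0: "fps_nth p 0 = 1" using f0[of 0 0] by (simp add: p_def P_def)
  have "P \<longlonglongrightarrow> p"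
    by (intro tendsto_fpsI) (auto simp: eventually_sequentially intro: stable)
  moreover have "p \<noteq> 0" using p0 by auto
  ultimately have hp: "?f has_prod p"
    unfolding has_prod_def raw_has_prod_def P_def by simp
  hence "euler_denom n = p" unfolding euler_denom_def by (metis has_prod_unique)
  thus ?A ?B using hp p0 by simp_all
qed

lemma sum_list_theta: "n \<ge> 2 \<Longrightarrow> sum_list (theta n) = n"
  by (simp add: theta_def sum_list_replicate)

lemma finite_dg: "finite (dg \<mu>)"
  by (rule finite_subset[of _ "{..length \<mu>} \<times> {..Max (set \<mu>)}"])
     (auto simp: dg_def intro!: order_trans[OF _ Max_ge])

lemma finite_C_fillings: "finite (C_fillings n k)"
  by (rule finite_subset[of _ "dg (k_theta n k) \<rightarrow>\<^sub>E {1..n}"])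
     (auto simp: C_fillings_def col_strict_fillings_def intro!: finite_PiE finite_dg)

lemma C_fillings_0: "C_fillings n 0 = {\<lambda>_. undefined}"
proof -
  have "k_theta n 0 ! (r - 1) = 0" if "1 \<le> r" "r \<le> length (k_theta n 0)" for r
    using that by (simp add: k_theta_def)
  hence "dg (k_theta n 0) = {}" by (fastforce simp: dg_def)
  thus ?thesis by (auto simp: C_fillings_def col_strict_fillings_def occurs_in_column_def)
qed

end

theory Submission
  imports Defs "HOL-Combinatorics.Multiset_Permutations"
begin

text \<open>
  A filling of shape \<open>k\<theta>\<close> amounts to two words of length \<open>k\<close>: the entries missing from the long
  columns and the entries of the single cells. In these terms \<open>k\<^sup>2 - inv\<close> is \<open>k\<close> plus the numbers of
  weak inversions of the two words (suitably read) minus the product of their numbers of letters \<open>1\<close>.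
  Prefixing both words by \<open>1\<close> changes neither this exponent nor the weight, and the pairs of words
  arising in this way are exactly those excluded from \<open>\<C>\<^sub>k\<close>, so the series telescopes: its \<open>k\<close>-th
  partial sum is the sum over all pairs of words of length \<open>k\<close>. Summed over words with prescribed
  contents \<open>\<alpha>\<close> and \<open>\<beta>\<close>, this is a product of two \<open>q\<close>-multinomial coefficients times
  \<open>q\<close> to the power \<open>\<parallel>\<beta> - \<alpha>\<parallel>\<^sup>2/2 + \<Sum>\<^sub>i\<^sub>\<ge>\<^sub>2 \<alpha>\<^sub>i \<beta>\<^sub>i\<close>. As \<open>k \<rightarrow> \<infinity>\<close> with \<open>\<gamma> = \<beta> - \<alpha>\<close> fixed, the coefficient of
  \<open>x\<^sup>\<gamma>\<close> becomes \<open>q\<close> to the power \<open>\<parallel>\<gamma>\<parallel>\<^sup>2/2\<close> times a product over \<open>i \<ge> 2\<close> of Durfee rectangle sums, each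
  equal to \<open>\<Prod>\<^sub>k (1 - q\<^sup>k)\<^sup>-\<^sup>1\<close>.
\<close>

subsection \<open>Congruence of power series\<close>

definition fps_cong :: "nat \<Rightarrow> 'a::comm_ring_1 fps \<Rightarrow> 'a fps \<Rightarrow> bool" where
  "fps_cong N f g \<longleftrightarrow> (\<forall>i<N. fps_nth f i = fps_nth g i)"

lemma fps_cong_refl [simp]: "fps_cong N f f"
  by (simp add: fps_cong_def)

lemma fps_cong_sym: "fps_cong N f g \<Longrightarrow> fps_cong N g f"
  by (simp add: fps_cong_def)

lemma fps_cong_trans [trans]: "fps_cong N f g \<Longrightarrow> fps_cong N g h \<Longrightarrow> fps_cong N f h"
  by (simp add: fps_cong_def)

lemma fps_cong_diff:
  "fps_cong N f g \<Longrightarrow> fps_cong N f' g' \<Longrightarrow> fps_cong N (f - f') (g - g')"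
  by (simp add: fps_cong_def)

lemma fps_cong_sum:
  assumes "\<And>x. x \<in> A \<Longrightarrow> fps_cong N (f x) (g x)"
  shows "fps_cong N (sum f A) (sum g A)"
  using assms by (auto simp: fps_cong_def fps_sum_nth intro!: sum.cong)

lemma fps_cong_mult:
  assumes "fps_cong N f g" "fps_cong N f' g'"
  shows "fps_cong N (f * f') (g * g')"
  using assms by (auto simp: fps_cong_def fps_mult_nth intro!: sum.cong)

lemma fps_cong_prod:
  assumes "\<And>x. x \<in> A \<Longrightarrow> fps_cong N (f x) (g x)"
  shows "fps_cong N (prod f A) (prod g A)"
  using assms
proof (induction A rule: infinite_finite_induct)
  case (insert x A)
  hence "fps_cong N (f x) (g x)" "fps_cong N (prod f A) (prod g A)" by simp_all
  thus ?case using insert.hyps by (simp add: fps_cong_mult)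
qed simp_all

lemma fps_cong_X_power_mult: "N \<le> m \<Longrightarrow> fps_cong N (fps_X ^ m * f) 0"
  by (auto simp: fps_cong_def fps_X_power_mult_nth)

text \<open>The product f' g' gives f' when multiplied by g, and g' when multiplied by f.\<close>

lemma fps_cong_right_inverse:
  assumes "fps_cong N f g" "f * f' = 1" "g * g' = 1"
  shows "fps_cong N f' g'"
proof -
  have "fps_cong N (f' * g' * g) (f' * g' * f)"
    by (intro fps_cong_mult fps_cong_refl fps_cong_sym[OF assms(1)])
  also have "f' * g' * f = g'" using assms(2) by (metis mult.assoc mult.commute mult.right_neutral)
  also have "f' * g' * g = f'" using assms(3) by (metis mult.assoc mult.commute mult.right_neutral)
  finally show ?thesis .
qed

text \<open>Serves for exponents that contain a difference: after multiplication by a power of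
  \<open>fps_X\<close> no subtraction is left.\<close>

lemma fps_X_power_mult_cancel:
  assumes "fps_X ^ m * f = fps_X ^ m * (g :: 'a::comm_ring_1 fps)"
  shows "f = g"
proof (rule fps_ext)
  fix i
  have "fps_nth (fps_X ^ m * f) (m + i) = fps_nth (fps_X ^ m * g) (m + i)" using assms by simp
  thus "fps_nth f i = fps_nth g i" by (simp add: fps_X_power_mult_nth)
qed

subsection \<open>The Durfee rectangle identity\<close>

text \<open>The q-Pochhammer symbol (q;q)_m, written (q)_m in the comments, with q =
  \<open>fps_X\<close>.\<close>

definition qpoch :: "nat \<Rightarrow> 'a::comm_ring_1 fps" where
  "qpoch m = (\<Prod>i=1..m. 1 - fps_X ^ i)"

definition inv_qpoch :: "nat \<Rightarrow> 'a::comm_ring_1 fps" where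
  "inv_qpoch m = fps_right_inverse (qpoch m) 1"

lemma qpoch_0 [simp]: "qpoch 0 = 1"
  by (simp add: qpoch_def)

lemma qpoch_Suc: "qpoch (Suc m) = qpoch m * (1 - fps_X ^ Suc m)"
  by (simp add: qpoch_def)

lemma qpoch_nth_0: "fps_nth (qpoch m) 0 = 1"
  by (induction m) (simp_all add: qpoch_Suc)

lemma qpoch_mult_inv_qpoch: "qpoch m * inv_qpoch m = 1"
  unfolding inv_qpoch_def by (rule fps_right_inverse) (simp add: qpoch_nth_0)

lemma inv_qpoch_0 [simp]: "inv_qpoch 0 = 1"
  using qpoch_mult_inv_qpoch[of 0] by simp

lemma inv_qpoch_Suc: "inv_qpoch m = (1 - fps_X ^ Suc m) * inv_qpoch (Suc m)"
proof -
  have "qpoch m * ((1 - fps_X ^ Suc m) * inv_qpoch (Suc m)) = (1 :: 'a fps)"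
    using qpoch_mult_inv_qpoch[of "Suc m"] by (simp add: qpoch_Suc mult.assoc)
  hence "inv_qpoch m * (qpoch m * ((1 - fps_X ^ Suc m) * inv_qpoch (Suc m))) = (inv_qpoch m :: 'a fps)"
    by simp
  thus ?thesis using qpoch_mult_inv_qpoch[of m] by (metis mult.assoc mult.commute mult.left_neutral)
qed

lemma fps_cong_qpoch:
  assumes "N \<le> m"
  shows "fps_cong N (qpoch m) (qpoch N)"
  using assms
proof (induction m rule: dec_induct)
  case (step m)
  have "fps_cong N (qpoch m - fps_X ^ Suc m * qpoch m) (qpoch m - 0 :: 'a fps)"
    by (intro fps_cong_diff fps_cong_X_power_mult fps_cong_refl) (use step in simp)
  also have "qpoch m - fps_X ^ Suc m * qpoch m = qpoch (Suc m)"
    by (simp add: qpoch_Suc algebra_simps)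
  also have "fps_cong N (qpoch m - 0) (qpoch N :: 'a fps)" using step.IH by simp
  finally show ?case .
qed simp

lemma fps_cong_inv_qpoch: "N \<le> m \<Longrightarrow> fps_cong N (inv_qpoch m) (inv_qpoch N)"
  by (rule fps_cong_right_inverse[OF fps_cong_qpoch qpoch_mult_inv_qpoch qpoch_mult_inv_qpoch])

text \<open>Counts partitions with an a by b Durfee rectangle: to its right stands a partition with
  at most a parts, below it one with parts at most b.\<close>

definition durfee_term :: "nat \<Rightarrow> nat \<Rightarrow> 'a::comm_ring_1 fps" where
  "durfee_term a b = fps_X ^ (a * b) * inv_qpoch a * inv_qpoch b"

text \<open>The terms with a > A start at exponent a (a + g), which is at least N.\<close>

lemma durfee_sum_cong_bound:
  assumes "A \<le> A'" "N \<le> Suc A * (Suc A + g)"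
  shows "fps_cong N (\<Sum>a\<le>A'. durfee_term a (a + g)) (\<Sum>a\<le>A. durfee_term a (a + g))"
  using assms(1)
proof (induction A' rule: dec_induct)
  case (step m)
  have "Suc A * (Suc A + g) \<le> Suc m * (Suc m + g)"
    using step by (intro mult_mono) auto
  hence "N \<le> Suc m * (Suc m + g)" using assms(2) by simp
  hence "fps_cong N (durfee_term (Suc m) (Suc m + g)) (0 :: 'a fps)"
    unfolding durfee_term_def mult.assoc by (rule fps_cong_X_power_mult)
  thus ?case using step.IH by (simp add: fps_cong_def)
qed simp

lemma durfee_term_diff_0:
  "durfee_term 0 g - durfee_term 0 (g + 1) = - (fps_X ^ (g + 1) * (durfee_term 0 (g + 1) :: 'a::comm_ring_1 fps))"
  by (simp add: durfee_term_def inv_qpoch_Suc[of g] inv_qpoch_Suc[of 0] algebra_simps)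

text \<open>Over the common denominator (q)_{a+1} (q)_{a+g+2} both sides have, up to the same power
  of q, the numerator 1 - q^(a+1) - q^(a+g+2).\<close>

lemma durfee_term_diff_Suc:
  "durfee_term (Suc a) (Suc a + g) - durfee_term (Suc a) (Suc a + (g + 1)) =
     fps_X ^ (g + 1) * (durfee_term a (a + (g + 2)) -
       (durfee_term (Suc a) (Suc a + (g + 1)) :: 'a::comm_ring_1 fps))"
proof -
  let ?P = "inv_qpoch (Suc a) * inv_qpoch (a + g + 2) :: 'a fps"
  have 1: "durfee_term (Suc a) (Suc a + g) =
             fps_X ^ (Suc a * (Suc a + g)) * (1 - fps_X ^ (a + g + 2)) * ?P"
    by (simp add: durfee_term_def inv_qpoch_Suc[of "Suc (a + g)"] mult_ac)
  have 2: "durfee_term (Suc a) (Suc a + (g + 1)) = fps_X ^ (Suc a * (a + g + 2)) * ?P"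
    by (simp add: durfee_term_def mult_ac)
  have 3: "durfee_term a (a + (g + 2)) = fps_X ^ (a * (a + g + 2)) * (1 - fps_X ^ Suc a) * ?P"
    by (simp add: durfee_term_def inv_qpoch_Suc[of a] mult_ac)
  show ?thesis unfolding 1 2 3
    by (simp add: algebra_simps power_add)
qed

text \<open>Truncated form of D_g - D_{g+1} = q^(g+1) (D_{g+2} - D_{g+1}) for the Durfee sums D_g.
  Terms of D_{g+2} are matched with the next terms of D_{g+1}; stopping D_{g+2} one term earlier
  makes the identity exact.\<close>

lemma durfee_sum_diff:
  "(\<Sum>a\<le>Suc A. durfee_term a (a + g)) - (\<Sum>a\<le>Suc A. durfee_term a (a + (g + 1))) =
     fps_X ^ (g + 1) * ((\<Sum>a\<le>A. durfee_term a (a + (g + 2))) -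
       ((\<Sum>a\<le>Suc A. durfee_term a (a + (g + 1))) :: 'a::comm_ring_1 fps))"
proof -
  have "(\<Sum>a\<le>Suc A. durfee_term a (a + g)) - (\<Sum>a\<le>Suc A. durfee_term a (a + (g + 1))) =
      (durfee_term 0 g - durfee_term 0 (g + 1)) +
      (\<Sum>a\<le>A. durfee_term (Suc a) (Suc a + g) - durfee_term (Suc a) (Suc a + (g + 1)) :: 'a fps)"
    unfolding sum.atMost_Suc_shift sum_subtractf by simp
  also have "\<dots> = fps_X ^ (g + 1) * ((\<Sum>a\<le>A. durfee_term a (a + (g + 2))) -
      (durfee_term 0 (g + 1) + (\<Sum>a\<le>A. durfee_term (Suc a) (Suc a + (g + 1)))))"
    unfolding durfee_term_diff_Suc durfee_term_diff_0 sum_distrib_left[symmetric] sum_subtractf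
    by (simp add: algebra_simps)
  finally show ?thesis unfolding sum.atMost_Suc_shift by simp
qed

text \<open>Iterating the recurrence makes D_g - D_{g+1} divisible by ever higher powers of q, so
  modulo q^N the sum does not depend on g. For large g only the term a = 0 survives, and it is
  1/(q)_g.\<close>

lemma durfee_sum_cong_aux:
  assumes "N \<le> Suc A"
  shows "fps_cong N (\<Sum>a\<le>A. durfee_term a (a + g)) (inv_qpoch N :: 'a::comm_ring_1 fps)"
proof -
  define f :: "nat \<Rightarrow> 'a fps" where "f g = (\<Sum>a\<le>Suc A. durfee_term a (a + g))" for g
  have f: "fps_cong N (f g) (\<Sum>a\<le>A. durfee_term a (a + g))" for g
    unfolding f_def by (rule durfee_sum_cong_bound) (use assms in auto)
  have step: "fps_cong N (f g - f (g + 1)) (fps_X ^ (g + 1) * (f (g + 2) - f (g + 1)))" for g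
    using durfee_sum_diff[where A = A and 'a = 'a and g = g, folded f_def]
    by (simp only:) (intro fps_cong_mult fps_cong_diff fps_cong_sym[OF f] fps_cong_refl)
  have const: "fps_cong N (f g) (f (g + 1))" for g
  proof -
    \<comment> \<open>Downward induction on g = N - j from g = N, where the factor q^(g+1) vanishes
      modulo q^N.\<close>
    have "fps_cong N (f (N - j) - f (N - j + 1)) 0" for j
    proof (induction j)
      case 0
      show ?case using fps_cong_trans[OF step fps_cong_X_power_mult] by simp
    next
      case (Suc j)
      show ?case
      proof (cases "Suc j \<le> N")
        case True
        hence eq: "N - j = N - Suc j + 1" by simp
        have "fps_cong N (f (N - Suc j) - f (N - Suc j + 1))
                (fps_X ^ (N - Suc j + 1) * (f (N - Suc j + 2) - f (N - Suc j + 1)))" by (rule step)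
        also have "fps_cong N \<dots> (fps_X ^ (N - Suc j + 1) * 0)"
          using Suc.IH unfolding eq
          by (intro fps_cong_mult fps_cong_refl) (simp add: fps_cong_def)
        finally show ?thesis by simp
      next
        case False
        thus ?thesis using Suc by simp
      qed
    qed
    from this[of "N - g"] show ?thesis
      using fps_cong_trans[OF step[of g] fps_cong_X_power_mult]
      by (cases "g \<le> N") (simp_all add: fps_cong_def)
  qed
  have shift: "fps_cong N (f g) (f (g + j))" for j
    by (induction j) (use const in \<open>auto intro: fps_cong_trans\<close>)
  have "fps_cong N (f g) (f (g + N))" by (rule shift)
  also have "fps_cong N (f (g + N)) (\<Sum>a\<le>0. durfee_term a (a + (g + N)))"
    unfolding f_def by (rule durfee_sum_cong_bound) auto
  also have "(\<Sum>a\<le>0. durfee_term a (a + (g + N))) = inv_qpoch (g + N)"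
    by (simp add: durfee_term_def)
  also have "fps_cong N \<dots> (inv_qpoch N :: 'a fps)" by (rule fps_cong_inv_qpoch) simp
  finally show ?thesis using f fps_cong_sym fps_cong_trans by blast
qed

lemma durfee_sum_cong:
  assumes "N \<le> Suc A * (Suc A + g)"
  shows "fps_cong N (\<Sum>a\<le>A. durfee_term a (a + g)) (inv_qpoch N :: 'a::comm_ring_1 fps)"
proof -
  have "fps_cong N (\<Sum>a\<le>A + N. durfee_term a (a + g)) (\<Sum>a\<le>A. durfee_term a (a + g) :: 'a fps)"
    by (rule durfee_sum_cong_bound) (use assms in auto)
  moreover have "fps_cong N (\<Sum>a\<le>A + N. durfee_term a (a + g)) (inv_qpoch N :: 'a fps)"
    by (rule durfee_sum_cong_aux) simp
  ultimately show ?thesis using fps_cong_sym fps_cong_trans by blast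
qed

text \<open>In the box a, b \<le> B the first omitted exponent is (B - h + 1) (B + 1) with h = |g|,
  which exceeds N even for h = B. Negative g is reduced to positive g by the symmetry of
  \<open>durfee_term\<close>.\<close>

lemma durfee_rectangle_cong:
  assumes "N \<le> B" "\<bar>g\<bar> \<le> int B"
  shows "fps_cong N (\<Sum>(a, b) | a \<le> B \<and> b \<le> B \<and> int b - int a = g. durfee_term a b)
           (inv_qpoch N :: 'a::comm_ring_1 fps)"
proof -
  define h where "h = nat \<bar>g\<bar>"
  have h: "h \<le> B" using assms by (simp add: h_def)
  have *: "fps_cong N (\<Sum>a\<le>B - h. durfee_term a (a + h)) (inv_qpoch N :: 'a fps)"
  proof (rule durfee_sum_cong)
    have "1 * (Suc (B - h) + h) \<le> Suc (B - h) * (Suc (B - h) + h)" by (rule mult_mono) auto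
    moreover have "1 * (Suc (B - h) + h) = Suc B" using h by simp
    ultimately show "N \<le> Suc (B - h) * (Suc (B - h) + h)" using assms(1) by linarith
  qed
  show ?thesis
  proof (cases "g \<ge> 0")
    case True
    have "(\<Sum>(a, b) | a \<le> B \<and> b \<le> B \<and> int b - int a = g. durfee_term a b) =
            (\<Sum>a\<le>B - h. durfee_term a (a + h) :: 'a fps)"
      by (rule sum.reindex_bij_witness[where i = "\<lambda>a. (a, a + h)" and j = fst])
        (use True h in \<open>auto simp: h_def nat_diff_distrib\<close>)
    thus ?thesis using * by simp
  next
    case False
    have "(\<Sum>(a, b) | a \<le> B \<and> b \<le> B \<and> int b - int a = g. durfee_term a b) =
            (\<Sum>a\<le>B - h. durfee_term a (a + h) :: 'a fps)"
      by (rule sum.reindex_bij_witness[where i = "\<lambda>a. (a + h, a)" and j = snd])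
        (use False h in \<open>auto simp: h_def nat_diff_distrib durfee_term_def mult_ac\<close>)
    thus ?thesis using * by simp
  qed
qed


subsection \<open>Weak inversions of words\<close>

fun weak_inv :: "nat list \<Rightarrow> nat" where
  "weak_inv [] = 0"
| "weak_inv (c # w) = length (filter (\<lambda>x. x \<le> c) w) + weak_inv w"

definition words :: "nat \<Rightarrow> nat \<Rightarrow> nat list set" where
  "words n k = {w. set w \<subseteq> {1..n} \<and> length w = k}"

definition contents :: "nat \<Rightarrow> nat \<Rightarrow> nat multiset set" where
  "contents n k = {M. set_mset M \<subseteq> {1..n} \<and> size M = k}"

lemma finite_words [simp]: "finite (words n k)"
  unfolding words_def by (rule finite_lists_length_eq) simp

lemma contents_eq_image: "contents n k = mset ` words n k"
  unfolding contents_def words_def image_def by (auto, metis ex_mset set_mset_mset size_mset)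

lemma finite_contents [simp]: "finite (contents n k)"
  by (simp add: contents_eq_image)

text \<open>Collects the contributions of all possible first letters c in
  \<open>weak_inv_generating_function\<close>.\<close>

lemma sum_size_filter_telescope:
  fixes M :: "nat multiset"
  assumes "set_mset M \<subseteq> {1..n}"
  shows "(\<Sum>c=1..n. fps_X ^ size {#x \<in># M. x < c#} * (1 - fps_X ^ count M c)) =
           (1 - fps_X ^ size M :: 'a::comm_ring_1 fps)"
proof -
  define f :: "nat \<Rightarrow> 'a fps" where "f c = fps_X ^ size {#x \<in># M. x < c#}" for c
  have split: "size {#x \<in># M. x < Suc c#} = size {#x \<in># M. x < c#} + count M c" for c
  proof -
    have "{#x \<in># M. x < Suc c#} = {#x \<in># M. x < c#} + {#x \<in># M. x = c#}"
      by (rule multiset_eqI) auto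
    thus ?thesis by (simp add: filter_eq_replicate_mset)
  qed
  have "(\<Sum>c=1..n. fps_X ^ size {#x \<in># M. x < c#} * (1 - fps_X ^ count M c)) =
          (\<Sum>c=1..n. f c - f (Suc c))"
    by (rule sum.cong) (simp_all add: f_def split power_add right_diff_distrib)
  also have "\<dots> = f 1 - f (Suc n)"
    by (induction n) simp_all
  also have "f (Suc n) = fps_X ^ size M"
  proof -
    have "{#x \<in># M. x < Suc n#} = M"
      using assms by (subst filter_mset_eq_conv) auto
    thus ?thesis by (simp add: f_def)
  qed
  also have "f 1 = 1"
  proof -
    have "{#x \<in># M. x < 1#} = {#}" using assms by (auto simp: filter_mset_eq_conv)
    thus ?thesis unfolding f_def by (simp only: size_empty power_0)
  qed
  finally show ?thesis .
qed

text \<open>MacMahon's theorem: strict inversions have the q-multinomial coefficient as generating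
  function, and each pair of equal letters is one additional weak inversion. The induction removes
  the first letter; denominators are multiplied out so that no division occurs.\<close>

lemma weak_inv_generating_function:
  assumes "set_mset M \<subseteq> {1..n}"
  shows "(\<Sum>w\<in>permutations_of_multiset M. fps_X ^ weak_inv w) * (\<Prod>i=1..n. qpoch (count M i)) =
           fps_X ^ (\<Sum>i=1..n. count M i choose 2) * (qpoch (size M) :: 'a::comm_ring_1 fps)"
  using assms
proof (induction "size M" arbitrary: M)
  case 0
  thus ?case by (simp add: numeral_2_eq_2)
next
  case (Suc k)
  let ?C = "\<lambda>M. \<Sum>i=1..n. count M i choose 2"
  let ?D = "\<lambda>M. \<Sum>w\<in>permutations_of_multiset M. fps_X ^ weak_inv w :: 'a fps"
  let ?Q = "\<lambda>M. \<Prod>i=1..n. qpoch (count M i) :: 'a fps"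
  have "M \<noteq> {#}" using Suc.hyps by auto
  \<comment> \<open>A first letter c contributes the number of smaller letters plus
    \<open>count M c - 1\<close>. The latter turns \<open>?C (M - {#c#})\<close> into
    \<open>?C M\<close>, while \<open>?Q M\<close> has the additional factor 1 -
    q^(\<open>count M c\<close>).\<close>
  have letter: "fps_X ^ size {#x \<in># M - {#c#}. x \<le> c#} * ?D (M - {#c#}) * ?Q M =
      fps_X ^ ?C M * qpoch k * (fps_X ^ size {#x \<in># M. x < c#} * (1 - fps_X ^ count M c))"
    if c: "c \<in># M" for c
  proof -
    define m where "m = count M c - 1"
    have m: "count M c = Suc m" using c by (simp add: m_def)
    have cn: "c \<in> {1..n}" using c Suc.prems by auto
    have cnt: "count (M - {#c#}) i = (if i = c then m else count M i)" for i
      by (auto simp: m)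
    have "?Q M = qpoch (Suc m) * (\<Prod>i\<in>{1..n} - {c}. qpoch (count M i))"
      using cn by (simp only: prod.remove[of "{1..n}" c] finite_atLeastAtMost m)
    also have "\<dots> = (1 - fps_X ^ Suc m) * (qpoch m * (\<Prod>i\<in>{1..n} - {c}. qpoch (count (M - {#c#}) i)))"
      by (simp add: qpoch_Suc cnt mult_ac)
    also have "qpoch m * (\<Prod>i\<in>{1..n} - {c}. qpoch (count (M - {#c#}) i)) = ?Q (M - {#c#})"
      using cn by (simp only: prod.remove[of "{1..n}" c] finite_atLeastAtMost cnt) simp
    finally have Q: "?Q M = (1 - fps_X ^ count M c) * ?Q (M - {#c#})" by (simp add: m)
    have "?C M = (Suc m choose 2) + (\<Sum>i\<in>{1..n} - {c}. count M i choose 2)"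
      using cn by (simp only: sum.remove[of "{1..n}" c] finite_atLeastAtMost m)
    also have "\<dots> = m + ((m choose 2) + (\<Sum>i\<in>{1..n} - {c}. count (M - {#c#}) i choose 2))"
      by (simp add: cnt numeral_2_eq_2)
    also have "(m choose 2) + (\<Sum>i\<in>{1..n} - {c}. count (M - {#c#}) i choose 2) = ?C (M - {#c#})"
      using cn by (simp only: sum.remove[of "{1..n}" c] finite_atLeastAtMost cnt) simp
    finally have C: "?C M = m + ?C (M - {#c#})" .
    have "{#x \<in># M - {#c#}. x \<le> c#} = {#x \<in># M. x < c#} + replicate_mset m c"
      by (rule multiset_eqI) (auto simp: m_def)
    hence size: "size {#x \<in># M - {#c#}. x \<le> c#} = size {#x \<in># M. x < c#} + m" by simp
    have ks: "k = size (M - {#c#})" using Suc.hyps(2) c by (simp add: size_Diff_singleton)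
    have "set_mset (M - {#c#}) \<subseteq> {1..n}" using Suc.prems by (auto dest: in_diffD)
    from Suc.hyps(1)[OF ks this]
    have IH: "?D (M - {#c#}) * ?Q (M - {#c#}) = fps_X ^ ?C (M - {#c#}) * qpoch k"
      unfolding ks[symmetric] .
    have "fps_X ^ size {#x \<in># M - {#c#}. x \<le> c#} * ?D (M - {#c#}) * ?Q M =
        fps_X ^ size {#x \<in># M - {#c#}. x \<le> c#} * (1 - fps_X ^ count M c) *
        (?D (M - {#c#}) * ?Q (M - {#c#}))"
      unfolding Q by (simp only: mult_ac)
    also have "\<dots> = fps_X ^ ?C M * qpoch k * (fps_X ^ size {#x \<in># M. x < c#} * (1 - fps_X ^ count M c))"
      unfolding IH C size power_add by (simp only: mult_ac)
    finally show ?thesis .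
  qed
  have "?D M = (\<Sum>c\<in>set_mset M. \<Sum>w\<in>(#) c ` permutations_of_multiset (M - {#c#}). fps_X ^ weak_inv w)"
    unfolding permutations_of_multiset_nonempty[OF \<open>M \<noteq> {#}\<close>]
    by (rule sum.UNION_disjoint) auto
  also have "\<dots> = (\<Sum>c\<in>set_mset M. fps_X ^ size {#x \<in># M - {#c#}. x \<le> c#} * ?D (M - {#c#}))"
  proof (rule sum.cong[OF refl])
    fix c assume "c \<in> set_mset M"
    have "length (filter (\<lambda>x. x \<le> c) w) = size {#x \<in># M - {#c#}. x \<le> c#}"
      if "w \<in> permutations_of_multiset (M - {#c#})" for w
      using permutations_of_multisetD[OF that] by (metis mset_filter size_mset)
    thus "(\<Sum>w\<in>(#) c ` permutations_of_multiset (M - {#c#}). fps_X ^ weak_inv w) =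
        fps_X ^ size {#x \<in># M - {#c#}. x \<le> c#} * ?D (M - {#c#})"
      by (subst sum.reindex) (auto simp: sum_distrib_left power_add intro!: sum.cong)
  qed
  finally have "?D M * ?Q M = (\<Sum>c\<in>set_mset M. fps_X ^ ?C M * qpoch k *
      (fps_X ^ size {#x \<in># M. x < c#} * (1 - fps_X ^ count M c)))"
    by (simp only: sum_distrib_right) (intro sum.cong refl letter)
  also have "\<dots> = (\<Sum>c=1..n. fps_X ^ ?C M * qpoch k *
      (fps_X ^ size {#x \<in># M. x < c#} * (1 - fps_X ^ count M c)))"
    \<comment> \<open>A letter that does not occur in M contributes the factor 1 - q^0 = 0.\<close>
    by (rule sum.mono_neutral_left) (use Suc.prems in \<open>auto simp: not_in_iff\<close>)
  also have "\<dots> = fps_X ^ ?C M * (qpoch k * (1 - fps_X ^ size M))"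
    unfolding sum_distrib_left[symmetric] sum_size_filter_telescope[OF Suc.prems] by (simp only: mult_ac)
  also have "qpoch k * (1 - fps_X ^ size M) = (qpoch (size M) :: 'a fps)"
    by (simp add: Suc.hyps(2)[symmetric] qpoch_Suc)
  finally show ?case .
qed

text \<open>The q-multinomial coefficient.\<close>

definition qmult :: "nat \<Rightarrow> nat multiset \<Rightarrow> 'a::comm_ring_1 fps" where
  "qmult n M = qpoch (size M) * (\<Prod>i=1..n. inv_qpoch (count M i))"

lemma sum_weak_inv:
  assumes "set_mset M \<subseteq> {1..n}"
  shows "(\<Sum>w\<in>permutations_of_multiset M. fps_X ^ weak_inv w) =
           fps_X ^ (\<Sum>i=1..n. count M i choose 2) * (qmult n M :: 'a::comm_ring_1 fps)"
proof -
  let ?D = "\<Sum>w\<in>permutations_of_multiset M. fps_X ^ weak_inv w :: 'a fps"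
  have "(\<Prod>i=1..n. qpoch (count M i)) * (\<Prod>i=1..n. inv_qpoch (count M i)) = (1 :: 'a fps)"
    by (simp add: prod.distrib[symmetric] qpoch_mult_inv_qpoch)
  hence "?D = ?D * (\<Prod>i=1..n. qpoch (count M i)) * (\<Prod>i=1..n. inv_qpoch (count M i))"
    by (simp add: mult.assoc)
  also have "\<dots> = fps_X ^ (\<Sum>i=1..n. count M i choose 2) * qmult n M"
    unfolding weak_inv_generating_function[OF assms] qmult_def by (simp only: mult_ac)
  finally show ?thesis .
qed

section \<open>Weights and exponents of pairs of words\<close>

definition mvec :: "nat multiset \<Rightarrow> expvec" where
  "mvec M = (\<Sum>x\<in>#M. Poly_Mapping.single x 1)"

lemma mvec_add_mset: "mvec (add_mset c M) = Poly_Mapping.single c 1 + mvec M"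
  by (simp add: mvec_def)

lemma lookup_mvec: "Poly_Mapping.lookup (mvec M) i = int (count M i)"
  by (induction M) (auto simp: mvec_def lookup_add lookup_single when_def)

text \<open>Equals \<open>k^2 - inv\<close> of the filling attached to (a, b), see
  \<open>inv_stat_word_filling\<close>.\<close>

definition word_exp :: "nat list \<Rightarrow> nat list \<Rightarrow> int" where
  "word_exp a b = int (length a) + int (weak_inv a) + int (weak_inv b)
     - int (count (mset a) 1) * int (count (mset b) 1)"

lemma length_filter_le_1:
  fixes w :: "nat list"
  assumes "0 \<notin> set w"
  shows "length (filter (\<lambda>x. x \<le> 1) w) = count (mset w) 1"
  using assms
proof (induction w)
  case (Cons c w)
  hence "c \<le> 1 \<longleftrightarrow> c = 1" by (cases c) auto
  thus ?case using Cons by auto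
qed simp

text \<open>Any two letters 1 form a weak inversion, so m of them give at least m (m - 1) /
  2.\<close>

lemma weak_inv_ge:
  assumes "0 \<notin> set w"
  shows "count (mset w) 1 * count (mset w) 1 \<le> 2 * weak_inv w + count (mset w) 1"
  using assms
proof (induction w)
  case (Cons c w)
  show ?case
  proof (cases "c = 1")
    case True
    have "length (filter (\<lambda>x. x \<le> 1) w) = count (mset w) 1"
      using Cons.prems by (intro length_filter_le_1) auto
    thus ?thesis using Cons True by simp
  next
    case False
    thus ?thesis using Cons by simp
  qed
qed simp

text \<open>If m and l are the numbers of letters 1, twice the exponent is at least (m - l)^2 + (k -
  m) + (k - l).\<close>

lemma word_exp_nonneg:
  assumes "a \<in> words n k" "b \<in> words n k"
  shows "0 \<le> word_exp a b"
proof -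
  define m l where "m = int (count (mset a) 1)" "l = int (count (mset b) 1)"
  have "0 \<notin> set a" "0 \<notin> set b" using assms by (auto simp: words_def)
  hence "m * m \<le> 2 * int (weak_inv a) + m" "l * l \<le> 2 * int (weak_inv b) + l"
    using weak_inv_ge[of a, folded of_nat_le_iff[where 'a = int]]
      weak_inv_ge[of b, folded of_nat_le_iff[where 'a = int]]
    unfolding m_l_def by simp_all
  moreover have "m \<le> int k" "l \<le> int k"
    using assms count_le_size[of "mset a" 1] count_le_size[of "mset b" 1]
    by (simp_all add: m_l_def words_def)
  moreover have "0 \<le> (m - l)\<^sup>2" by simp
  hence "2 * (m * l) \<le> m * m + l * l" by (simp add: power2_eq_square algebra_simps)
  ultimately have "0 \<le> 2 * word_exp a b"
    using assms unfolding word_exp_def m_l_def[symmetric] by (simp add: words_def)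
  thus ?thesis by simp
qed

text \<open>With m and l letters 1, the new first letters add 1 to the length and m + l to the weak
  inversions; the product grows from m l to (m + 1) (l + 1), which is the same amount.\<close>

lemma word_exp_Cons_1:
  assumes "0 \<notin> set a" "0 \<notin> set b"
  shows "word_exp (1 # a) (1 # b) = word_exp a b"
  using assms by (simp add: word_exp_def length_filter_le_1[simplified] algebra_simps)

text \<open>The subtraction does not truncate, by \<open>content_exp\<close> below.\<close>

definition content_exp :: "nat \<Rightarrow> nat multiset \<Rightarrow> nat multiset \<Rightarrow> nat" where
  "content_exp n M M' = size M + (\<Sum>i=1..n. count M i choose 2) + (\<Sum>i=1..n. count M' i choose 2)
     - count M 1 * count M' 1"

lemma two_times_choose_two: "2 * int (m choose 2) = int m * int m - int m"
  by (induction m) (simp_all add: numeral_2_eq_2 algebra_simps)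

lemma size_eq_sum_count:
  fixes M :: "nat multiset"
  assumes "set_mset M \<subseteq> {1..n}"
  shows "size M = (\<Sum>i=1..n. count M i)"
  unfolding size_multiset_overloaded_eq
  by (rule sum.mono_neutral_left) (use assms in \<open>auto simp: not_in_iff simp del: One_nat_def\<close>)

text \<open>Doubling turns each binomial into c^2 - c, and the linear terms cancel 2 k because both
  contents have size k. The terms of the letter 1 then complete to a square.\<close>

lemma content_exp:
  assumes "n \<ge> 1" "M \<in> contents n k" "M' \<in> contents n k"
  shows "count M 1 * count M' 1 + content_exp n M M' =
           k + (\<Sum>i=1..n. count M i choose 2) + (\<Sum>i=1..n. count M' i choose 2)" (is ?A)
    and "2 * int (content_exp n M M') =
           (int (count M 1) - int (count M' 1))\<^sup>2 +
           (\<Sum>i=2..n. int (count M i) ^ 2 + int (count M' i) ^ 2)" (is ?B)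
proof -
  let ?S = "k + (\<Sum>i=1..n. count M i choose 2) + (\<Sum>i=1..n. count M' i choose 2)"
  have C: "2 * int (\<Sum>i=1..n. count M i choose 2) = (\<Sum>i=1..n. int (count M i) ^ 2) - int k"
    if "M \<in> contents n k" for M
  proof -
    have "int k = (\<Sum>i=1..n. int (count M i))"
      using that size_eq_sum_count[of M n] by (simp add: contents_def)
    thus ?thesis
      by (simp add: sum_distrib_left two_times_choose_two sum_subtractf power2_eq_square)
  qed
  have "2 * int ?S = (\<Sum>i=1..n. int (count M i) ^ 2) + (\<Sum>i=1..n. int (count M' i) ^ 2)"
    using C[OF assms(2)] C[OF assms(3)] by simp
  also have "\<dots> = (\<Sum>i=1..n. int (count M i) ^ 2 + int (count M' i) ^ 2)"
    by (simp add: sum.distrib)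
  also have "\<dots> = (int (count M 1) ^ 2 + int (count M' 1) ^ 2) +
      (\<Sum>i=2..n. int (count M i) ^ 2 + int (count M' i) ^ 2)"
    using assms(1) by (subst sum.atLeast_Suc_atMost) (simp_all add: numeral_2_eq_2)
  finally have S: "2 * int ?S = 2 * int (count M 1 * count M' 1) +
      ((int (count M 1) - int (count M' 1))\<^sup>2 +
      (\<Sum>i=2..n. int (count M i) ^ 2 + int (count M' i) ^ 2))"
    by (simp add: power2_eq_square algebra_simps)
  have "0 \<le> (int (count M 1) - int (count M' 1))\<^sup>2 +
      (\<Sum>i=2..n. int (count M i) ^ 2 + int (count M' i) ^ 2)"
    by (intro add_nonneg_nonneg sum_nonneg) auto
  hence "2 * int (count M 1 * count M' 1) \<le> 2 * int ?S"
    unfolding S by (simp only: le_add_same_cancel1)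
  hence "count M 1 * count M' 1 \<le> ?S"
    by (simp only: mult_le_cancel_left_pos of_nat_le_iff zero_less_numeral)
  moreover have "content_exp n M M' = ?S - count M 1 * count M' 1"
    using assms(2) by (simp add: content_exp_def contents_def)
  ultimately show ?A by simp
  hence "int (count M 1 * count M' 1) + int (content_exp n M M') = int ?S"
    by (simp only: of_nat_add[symmetric])
  hence "2 * int (content_exp n M M') + 2 * int (count M 1 * count M' 1) = 2 * int ?S"
    by (metis add.commute distrib_left)
  thus ?B unfolding S by simp
qed

text \<open>Will be a partial sum over fillings, by \<open>partial_sum_C_fillings\<close>. The
  conversion \<open>nat\<close> is faithful by \<open>word_exp_nonneg\<close>.\<close>

definition word_series :: "nat \<Rightarrow> nat \<Rightarrow> laurent_poly fps" where
  "word_series n k = (\<Sum>a\<in>words n k. \<Sum>b\<in>words n k.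
     fps_const (x_pow (mvec (mset b) - mvec (mset a))) * fps_X ^ nat (word_exp a b))"

lemma sum_words_contents:
  "(\<Sum>w\<in>words n k. f w) = (\<Sum>M\<in>contents n k. \<Sum>w\<in>permutations_of_multiset M. f w)"
proof -
  have "(\<Sum>w\<in>words n k. f w) = (\<Sum>M\<in>contents n k. \<Sum>w | w \<in> words n k \<and> mset w = M. f w)"
    by (rule sum.group[symmetric]) (auto simp: contents_eq_image)
  also have "\<dots> = (\<Sum>M\<in>contents n k. \<Sum>w\<in>permutations_of_multiset M. f w)"
    by (intro sum.cong refl) (auto simp: contents_def words_def permutations_of_multiset_def)
  finally show ?thesis .
qed

text \<open>The product of the numbers of letters 1 is constant on given contents. Moved to the
  other side, it leaves an exponent that separates into a part for a and a part for b, so the double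
  sum factors.\<close>

lemma sum_word_exp:
  assumes "n \<ge> 1" "M \<in> contents n k" "M' \<in> contents n k"
  shows "(\<Sum>a\<in>permutations_of_multiset M. \<Sum>b\<in>permutations_of_multiset M'.
            fps_X ^ nat (word_exp a b)) =
         fps_X ^ content_exp n M M' * (qmult n M * qmult n M' :: 'a::comm_ring_1 fps)"
proof (rule fps_X_power_mult_cancel)
  let ?c = "count M 1 * count M' 1"
  let ?P = "permutations_of_multiset"
  have "fps_X ^ ?c * fps_X ^ nat (word_exp a b) =
      (fps_X ^ k * (fps_X ^ weak_inv a * fps_X ^ weak_inv b) :: 'a fps)"
    if "a \<in> ?P M" "b \<in> ?P M'" for a b
  proof -
    have ab: "mset a = M" "mset b = M'" using that by (simp_all add: permutations_of_multiset_def)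
    hence "a \<in> words n k" "b \<in> words n k"
      using assms by (auto simp: contents_def words_def)
    hence "0 \<le> word_exp a b" "length a = k" using word_exp_nonneg by (auto simp: words_def)
    moreover have "int ?c + word_exp a b = int (k + (weak_inv a + weak_inv b))"
      using \<open>length a = k\<close> by (simp add: word_exp_def ab)
    ultimately have "?c + nat (word_exp a b) = k + (weak_inv a + weak_inv b)" by linarith
    thus ?thesis by (simp only: power_add[symmetric])
  qed
  hence "fps_X ^ ?c * (\<Sum>a\<in>?P M. \<Sum>b\<in>?P M'. fps_X ^ nat (word_exp a b)) =
      (\<Sum>a\<in>?P M. \<Sum>b\<in>?P M'. fps_X ^ k * (fps_X ^ weak_inv a * fps_X ^ weak_inv b) :: 'a fps)"
    by (simp only: sum_distrib_left) (intro sum.cong refl, simp)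
  also have "\<dots> = fps_X ^ k * ((\<Sum>a\<in>?P M. fps_X ^ weak_inv a) * (\<Sum>b\<in>?P M'. fps_X ^ weak_inv b))"
    by (subst sum_product) (simp only: sum_distrib_left)
  also have "\<dots> = fps_X ^ (k + (\<Sum>i=1..n. count M i choose 2) + (\<Sum>i=1..n. count M' i choose 2)) *
      (qmult n M * qmult n M')"
    using assms by (subst (1 2) sum_weak_inv[where n = n]) (auto simp: contents_def power_add mult_ac)
  also have "\<dots> = fps_X ^ ?c * (fps_X ^ content_exp n M M' * (qmult n M * qmult n M'))"
    unfolding content_exp(1)[OF assms, symmetric] by (simp only: power_add mult_ac)
  finally show "fps_X ^ ?c * (\<Sum>a\<in>?P M. \<Sum>b\<in>?P M'. fps_X ^ nat (word_exp a b)) =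
      fps_X ^ ?c * (fps_X ^ content_exp n M M' * (qmult n M * qmult n M' :: 'a fps))" .
qed

lemma word_series_contents:
  assumes "n \<ge> 1"
  shows "word_series n k = (\<Sum>M\<in>contents n k. \<Sum>M'\<in>contents n k.
     fps_const (x_pow (mvec M' - mvec M)) * fps_X ^ content_exp n M M' * qmult n M * qmult n M')"
proof -
  let ?P = "permutations_of_multiset"
  have "word_series n k = (\<Sum>M\<in>contents n k. \<Sum>a\<in>?P M. \<Sum>M'\<in>contents n k. \<Sum>b\<in>?P M'.
      fps_const (x_pow (mvec (mset b) - mvec (mset a))) * fps_X ^ nat (word_exp a b))"
    unfolding word_series_def sum_words_contents ..
  also have "\<dots> = (\<Sum>M\<in>contents n k. \<Sum>M'\<in>contents n k. \<Sum>a\<in>?P M. \<Sum>b\<in>?P M'.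
      fps_const (x_pow (mvec M' - mvec M)) * fps_X ^ nat (word_exp a b))"
    by (subst sum.swap) (auto intro!: sum.cong simp: permutations_of_multiset_def)
  also have "\<dots> = (\<Sum>M\<in>contents n k. \<Sum>M'\<in>contents n k.
      fps_const (x_pow (mvec M' - mvec M)) * fps_X ^ content_exp n M M' * qmult n M * qmult n M')"
    using assms by (intro sum.cong refl)
      (simp add: sum_distrib_left[symmetric] sum_word_exp mult.assoc)
  finally show ?thesis .
qed


subsection \<open>The limit of the word series\<close>

text \<open>In the q-adic topology each coefficient of the limit is attained by almost all partial
  products, and below q^N these agree with (q)_N^(n-1) from m = N on.\<close>

lemma fps_cong_euler_denom: "fps_cong N (euler_denom n) (qpoch N ^ (n - 1))"
proof -
  let ?f = "\<lambda>k. (1 - fps_X ^ Suc k) ^ (n - 1) :: laurent_poly fps"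
  have partial: "(\<Prod>k\<le>m. ?f k) = qpoch (Suc m) ^ (n - 1)" for m
    by (induction m) (simp_all add: qpoch_Suc power_mult_distrib)
  have cong: "fps_cong N (qpoch (Suc m) ^ (n - 1)) (qpoch N ^ (n - 1) :: laurent_poly fps)"
    if "N \<le> m" for m
  proof -
    have "fps_cong N (\<Prod>i<n - 1. qpoch (Suc m)) (\<Prod>i<n - 1. qpoch N :: laurent_poly fps)"
      by (intro fps_cong_prod fps_cong_qpoch) (use that in simp)
    thus ?thesis by simp
  qed
  have "euler_denom n \<noteq> 0" using euler_denom_has_prod(2)[of n] by auto
  hence "(\<lambda>m. \<Prod>k\<le>m. ?f k) \<longlonglongrightarrow> euler_denom n"
    using euler_denom_has_prod(1)[of n] by (simp add: has_prod_def raw_has_prod_def)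
  hence lim: "\<forall>\<^sub>F m in sequentially. fps_nth (qpoch (Suc m) ^ (n - 1)) i = fps_nth (euler_denom n) i" for i
    unfolding tendsto_fps_iff partial by blast
  show ?thesis unfolding fps_cong_def
  proof (intro allI impI)
    fix i assume i: "i < N"
    have "\<forall>\<^sub>F m in sequentially. fps_nth (euler_denom n) i = fps_nth (qpoch N ^ (n - 1)) i"
      using lim[of i] eventually_ge_at_top[of N]
      by eventually_elim (use cong i in \<open>auto simp: fps_cong_def\<close>)
    thus "fps_nth (euler_denom n) i = fps_nth (qpoch N ^ (n - 1)) i" by simp
  qed
qed

lemma fps_cong_chi: "fps_cong N (chi n) (Theta n * inv_qpoch N ^ (n - 1))"
  unfolding chi_def
proof (intro fps_cong_mult fps_cong_refl)
  show "fps_cong N (fps_right_inverse (euler_denom n) 1) (inv_qpoch N ^ (n - 1))"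
  proof (rule fps_cong_right_inverse[OF fps_cong_euler_denom])
    show "euler_denom n * fps_right_inverse (euler_denom n) 1 = 1"
      by (rule fps_right_inverse) (simp add: euler_denom_has_prod(2))
    show "qpoch N ^ (n - 1) * inv_qpoch N ^ (n - 1) = (1 :: laurent_poly fps)"
      by (simp add: power_mult_distrib[symmetric] qpoch_mult_inv_qpoch)
  qed
qed

section \<open>The theta series modulo a power of q\<close>

definition root_lattice :: "nat \<Rightarrow> expvec set" where
  "root_lattice n = {\<gamma> \<in> exp_lattice n. coord_sum n \<gamma> = 0}"

text \<open>Well defined on \<open>root_lattice n\<close> by
  \<open>norm_sq_half_nat\<close>.\<close>

definition theta_exp :: "nat \<Rightarrow> expvec \<Rightarrow> nat" where
  "theta_exp n \<gamma> = (THE m. norm_sq n \<gamma> / 2 = real m)"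

lemma theta_exp:
  assumes "\<gamma> \<in> root_lattice n"
  shows "norm_sq n \<gamma> / 2 = real m \<longleftrightarrow> theta_exp n \<gamma> = m"
proof -
  have ex1: "\<exists>!m. norm_sq n \<gamma> / 2 = real m"
    using assms by (intro norm_sq_half_nat) (simp add: root_lattice_def)
  have "norm_sq n \<gamma> / 2 = real (theta_exp n \<gamma>)"
    unfolding theta_exp_def by (rule theI'[OF ex1])
  thus ?thesis by (metis of_nat_eq_iff)
qed

lemma two_times_theta_exp:
  assumes "\<gamma> \<in> root_lattice n"
  shows "2 * int (theta_exp n \<gamma>) = (\<Sum>i=1..n. Poly_Mapping.lookup \<gamma> i ^ 2)"
proof -
  have "norm_sq n \<gamma> / 2 = real (theta_exp n \<gamma>)" using theta_exp[OF assms] by blast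
  hence "2 * real (theta_exp n \<gamma>) = norm_sq n \<gamma>" by simp
  also have "\<dots> = real_of_int (\<Sum>i=1..n. Poly_Mapping.lookup \<gamma> i ^ 2)"
    using assms by (simp add: norm_sq_def root_lattice_def)
  finally have "real_of_int (2 * int (theta_exp n \<gamma>)) =
      real_of_int (\<Sum>i=1..n. Poly_Mapping.lookup \<gamma> i ^ 2)" by simp
  thus ?thesis by (simp only: of_int_eq_iff)
qed

text \<open>Vectors of exponent at least N are invisible modulo q^N, so any finite G containing the
  shorter ones will do.\<close>

lemma fps_cong_Theta:
  assumes "finite G" "G \<subseteq> root_lattice n"
    and "\<And>\<gamma>. \<gamma> \<in> root_lattice n \<Longrightarrow> theta_exp n \<gamma> < N \<Longrightarrow> \<gamma> \<in> G"
  shows "fps_cong N (Theta n) (\<Sum>\<gamma>\<in>G. fps_const (x_pow \<gamma>) * fps_X ^ theta_exp n \<gamma>)"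
  unfolding fps_cong_def
proof (intro allI impI)
  fix m assume m: "m < N"
  have "{\<gamma>. \<gamma> \<in> exp_lattice n \<and> coord_sum n \<gamma> = 0 \<and> norm_sq n \<gamma> / 2 = real m} =
      {\<gamma> \<in> G. theta_exp n \<gamma> = m}" (is "?A = _")
    using assms m theta_exp by (auto simp: root_lattice_def)
  hence "fps_nth (Theta n) m = (\<Sum>\<gamma> | \<gamma> \<in> G \<and> theta_exp n \<gamma> = m. x_pow \<gamma>)"
    by (simp add: Theta_def)
  also have "\<dots> = (\<Sum>\<gamma>\<in>G. if m = theta_exp n \<gamma> then x_pow \<gamma> else 0)"
    using assms(1) by (intro sum.mono_neutral_cong_left) auto
  also have "\<dots> = fps_nth (\<Sum>\<gamma>\<in>G. fps_const (x_pow \<gamma>) * fps_X ^ theta_exp n \<gamma>) m"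
    by (simp add: fps_sum_nth if_distrib cong: if_cong)
  finally show "fps_nth (Theta n) m =
      fps_nth (\<Sum>\<gamma>\<in>G. fps_const (x_pow \<gamma>) * fps_X ^ theta_exp n \<gamma>) m" .
qed

text \<open>The letter 1 is left unbounded: it makes up the size k, so its multiplicity grows with
  k.\<close>

definition bounded_contents :: "nat \<Rightarrow> nat \<Rightarrow> nat \<Rightarrow> nat multiset set" where
  "bounded_contents n k B = {M \<in> contents n k. \<forall>i\<in>{2..n}. count M i \<le> B}"

definition bounded_roots :: "nat \<Rightarrow> nat \<Rightarrow> expvec set" where
  "bounded_roots n B = {\<gamma> \<in> root_lattice n. \<forall>i\<in>{2..n}. \<bar>Poly_Mapping.lookup \<gamma> i\<bar> \<le> int B}"

lemma sum_split_first:
  assumes "n \<ge> (1::nat)"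
  shows "(\<Sum>i=1..n. f i) = f 1 + (\<Sum>i=2..n. f i)"
  using assms by (subst sum.atLeast_Suc_atMost) (simp_all add: numeral_2_eq_2)

lemma root_lattice_coord_1:
  assumes "n \<ge> 1" "\<gamma> \<in> root_lattice n"
  shows "Poly_Mapping.lookup \<gamma> 1 = - (\<Sum>i=2..n. Poly_Mapping.lookup \<gamma> i)"
  using assms sum_split_first[OF assms(1), of "Poly_Mapping.lookup \<gamma>"]
  by (simp add: root_lattice_def coord_sum_def)

lemma finite_bounded_roots [simp]:
  assumes "n \<ge> 1"
  shows "finite (bounded_roots n B)"
proof (rule finite_imageD)
  let ?R = "\<lambda>\<gamma>::expvec. restrict (Poly_Mapping.lookup \<gamma>) {2..n}"
  have "?R ` bounded_roots n B \<subseteq> {2..n} \<rightarrow>\<^sub>E {- int B..int B}"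
    by (force simp: bounded_roots_def abs_le_iff)
  thus "finite (?R ` bounded_roots n B)" by (rule finite_subset) (intro finite_PiE; simp)
  show "inj_on ?R (bounded_roots n B)"
  proof (rule inj_onI, rule poly_mapping_eqI)
    fix a b i assume a: "a \<in> bounded_roots n B" and b: "b \<in> bounded_roots n B" and eq: "?R a = ?R b"
    have on: "Poly_Mapping.lookup a j = Poly_Mapping.lookup b j" if "j \<in> {2..n}" for j
      using that fun_cong[OF eq, of j] by simp
    have "Poly_Mapping.lookup a 1 = Poly_Mapping.lookup b 1"
    proof -
      have "a \<in> root_lattice n" "b \<in> root_lattice n" using a b by (simp_all add: bounded_roots_def)
      moreover have "(\<Sum>i=2..n. Poly_Mapping.lookup a i) = (\<Sum>i=2..n. Poly_Mapping.lookup b i)"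
        by (intro sum.cong refl on)
      ultimately show ?thesis using root_lattice_coord_1[OF assms] by (simp only:)
    qed
    moreover have "Poly_Mapping.lookup a i = 0" "Poly_Mapping.lookup b i = 0" if "i \<notin> {1..n}"
      using a b that
      by (auto simp: bounded_roots_def root_lattice_def exp_lattice_def subset_iff Poly_Mapping.in_keys_iff)
    moreover have "i \<in> {2..n} \<or> i = 1 \<or> i \<notin> {1..n}" by auto
    ultimately show "Poly_Mapping.lookup a i = Poly_Mapping.lookup b i" using on by metis
  qed
qed

text \<open>A coordinate c of a vector with exponent below N satisfies |c| \<le> c^2 \<le> 2
  \<open>theta_exp\<close> \<le> B.\<close>

lemma fps_cong_Theta_bounded_roots:
  assumes "n \<ge> 1" "2 * N \<le> B"
  shows "fps_cong N (Theta n)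
           (\<Sum>\<gamma>\<in>bounded_roots n B. fps_const (x_pow \<gamma>) * fps_X ^ theta_exp n \<gamma>)"
proof (rule fps_cong_Theta)
  fix \<gamma> assume \<gamma>: "\<gamma> \<in> root_lattice n" "theta_exp n \<gamma> < N"
  have "\<bar>Poly_Mapping.lookup \<gamma> i\<bar> \<le> int B" if "i \<in> {2..n}" for i
  proof -
    let ?c = "Poly_Mapping.lookup \<gamma> i"
    have "\<bar>?c\<bar> \<le> ?c ^ 2"
      using self_le_power[of "\<bar>?c\<bar>" 2] by (cases "?c = 0") auto
    also have "?c ^ 2 \<le> (\<Sum>i=1..n. Poly_Mapping.lookup \<gamma> i ^ 2)"
      by (rule member_le_sum) (use that in auto)
    also have "\<dots> = 2 * int (theta_exp n \<gamma>)" using two_times_theta_exp[OF \<gamma>(1)] by simp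
    also have "\<dots> \<le> int B" using \<gamma>(2) assms(2) by simp
    finally show ?thesis .
  qed
  thus "\<gamma> \<in> bounded_roots n B" using \<gamma> by (simp add: bounded_roots_def)
next
  show "bounded_roots n B \<subseteq> root_lattice n" by (auto simp: bounded_roots_def)
qed (rule finite_bounded_roots[OF assms(1)])

lemma sum_count_contents:
  assumes "M \<in> contents n k"
  shows "(\<Sum>i=1..n. count M i) = k"
  using assms size_eq_sum_count[of M n] by (simp add: contents_def)

lemma mvec_diff_root_lattice:
  assumes "M \<in> contents n k" "M' \<in> contents n k"
  shows "mvec M' - mvec M \<in> root_lattice n"
proof -
  have "Poly_Mapping.lookup (mvec M' - mvec M) i = int (count M' i) - int (count M i)" for i
    by (simp add: lookup_minus lookup_mvec)
  moreover have "(\<Sum>i=1..n. int (count M i)) = int k" "(\<Sum>i=1..n. int (count M' i)) = int k"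
    using assms by (simp_all only: of_nat_sum[symmetric] sum_count_contents)
  moreover have "count M i = 0" "count M' i = 0" if "i \<notin> {1..n}" for i
    using assms that by (auto simp: contents_def subset_iff simp flip: not_in_iff)
  ultimately show ?thesis
    by (auto simp: root_lattice_def exp_lattice_def coord_sum_def sum_subtractf Poly_Mapping.in_keys_iff)
      (metis atLeastAtMost_iff diff_self of_nat_0)+
qed

text \<open>In each coordinate i \<ge> 2 the identity s^2 + t^2 = (t - s)^2 + 2 s t applies, while
  coordinate 1 enters only through its difference already.\<close>

lemma content_exp_eq_theta_exp:
  assumes "n \<ge> 1" "M \<in> contents n k" "M' \<in> contents n k"
  shows "content_exp n M M' = theta_exp n (mvec M' - mvec M) + (\<Sum>i=2..n. count M i * count M' i)"
proof -
  have "2 * int (content_exp n M M') =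
      2 * int (theta_exp n (mvec M' - mvec M)) + 2 * (\<Sum>i=2..n. int (count M i) * int (count M' i))"
    unfolding content_exp(2)[OF assms] two_times_theta_exp[OF mvec_diff_root_lattice[OF assms(2,3)]]
      sum_split_first[OF assms(1)]
    by (simp add: lookup_minus lookup_mvec sum_distrib_left power2_diff sum.distrib sum_subtractf
        power2_commute algebra_simps)
  hence "int (content_exp n M M') =
      int (theta_exp n (mvec M' - mvec M) + (\<Sum>i=2..n. count M i * count M' i))"
    by simp
  thus ?thesis by (simp only: of_nat_eq_iff)
qed

lemma count_1_bounded_contents:
  assumes "n \<ge> 1" "n * B + N \<le> k" "M \<in> bounded_contents n k B"
  shows "N \<le> count M 1"
proof -
  have "(\<Sum>i=2..n. count M i) \<le> (\<Sum>i=2..n. B)"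
    by (rule sum_mono) (use assms(3) in \<open>auto simp: bounded_contents_def\<close>)
  also have "\<dots> \<le> n * B" by simp
  finally have "(\<Sum>i=2..n. count M i) \<le> n * B" .
  moreover have "k = count M 1 + (\<Sum>i=2..n. count M i)"
    using assms(3) size_eq_sum_count[of M n] sum_split_first[OF assms(1), of "count M"]
    by (simp add: bounded_contents_def contents_def)
  ultimately show ?thesis using assms(2) by linarith
qed

text \<open>Both k and the multiplicity of 1 are at least N, so modulo q^N the factor (q)_k cancels
  the denominator of the letter 1.\<close>

lemma fps_cong_qmult:
  assumes "n \<ge> 1" "n * B + N \<le> k" "M \<in> bounded_contents n k B"
  shows "fps_cong N (qmult n M) (\<Prod>i=2..n. inv_qpoch (count M i) :: 'a::comm_ring_1 fps)"
proof -
  let ?P = "\<Prod>i=2..n. inv_qpoch (count M i) :: 'a fps"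
  have "qmult n M = qpoch k * inv_qpoch (count M 1) * ?P"
    using assms by (subst qmult_def, subst prod.atLeast_Suc_atMost)
      (simp_all add: numeral_2_eq_2 bounded_contents_def contents_def mult.assoc)
  also have "fps_cong N \<dots> (qpoch N * inv_qpoch N * ?P)"
    by (intro fps_cong_mult fps_cong_refl fps_cong_qpoch fps_cong_inv_qpoch
        count_1_bounded_contents[OF assms]) (use assms(2) in simp)
  finally show ?thesis by (simp add: qpoch_mult_inv_qpoch)
qed

text \<open>A multiplicity c > B of some letter i \<ge> 2 gives 2 \<open>content_exp\<close> \<ge>
  c^2 \<ge> B \<ge> 2 N. Such pairs of contents vanish modulo q^N.\<close>

lemma content_exp_ge:
  assumes "n \<ge> 1" "M \<in> contents n k" "M' \<in> contents n k" "2 * N \<le> B"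
    and "M \<notin> bounded_contents n k B \<or> M' \<notin> bounded_contents n k B"
  shows "N \<le> content_exp n M M'"
proof -
  obtain i where i: "i \<in> {2..n}" "B < count M i \<or> B < count M' i"
    using assms by (auto simp: bounded_contents_def not_le)
  have sq: "int B \<le> int c ^ 2" if "B < c" for c
    using that self_le_power[of "int c" 2] by linarith
  have "int (2 * N) \<le> int (count M i) ^ 2 + int (count M' i) ^ 2"
    using i(2) sq[of "count M i"] sq[of "count M' i"] assms(4)
      zero_le_power2[of "int (count M i)"] zero_le_power2[of "int (count M' i)"]
    by linarith
  also have "\<dots> \<le> (\<Sum>i=2..n. int (count M i) ^ 2 + int (count M' i) ^ 2)"
    by (rule member_le_sum) (use i in auto)
  also have "\<dots> \<le> 2 * int (content_exp n M M')"
    unfolding content_exp(2)[OF assms(1-3)] by simp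
  finally show ?thesis by simp
qed

section \<open>Pairs of contents with prescribed difference\<close>

definition root_pairs :: "nat \<Rightarrow> nat \<Rightarrow> nat \<Rightarrow> expvec \<Rightarrow> (nat multiset \<times> nat multiset) set" where
  "root_pairs n k B \<gamma> = {(M, M') \<in> bounded_contents n k B \<times> bounded_contents n k B. mvec M' - mvec M = \<gamma>}"

text \<open>Inverse to reading off the multiplicities of 2 to n; the subtraction is a true one when
  these sum to at most k.\<close>

definition mset_of_counts :: "nat \<Rightarrow> nat \<Rightarrow> (nat \<Rightarrow> nat) \<Rightarrow> nat multiset" where
  "mset_of_counts n k f =
     (\<Sum>i\<in>{2..n}. replicate_mset (f i) i) + replicate_mset (k - (\<Sum>i=2..n. f i)) 1"

lemma count_mset_of_counts:
  "count (mset_of_counts n k f) j =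
     (if j = 1 then k - (\<Sum>i=2..n. f i) else if j \<in> {2..n} then f j else 0)"
  by (auto simp: mset_of_counts_def count_sum)

lemma mset_of_counts_contents:
  assumes "n \<ge> 1" "(\<Sum>i=2..n. f i) \<le> k"
  shows "mset_of_counts n k f \<in> contents n k"
proof -
  have sub: "set_mset (mset_of_counts n k f) \<subseteq> {1..n}"
    using assms(1) by (auto simp: set_mset_def count_mset_of_counts split: if_splits)
  have "size (mset_of_counts n k f) = k"
    unfolding size_eq_sum_count[OF sub] sum_split_first[OF assms(1)]
    using assms(2) by (simp add: count_mset_of_counts)
  with sub show ?thesis by (simp add: contents_def)
qed

lemma mset_of_counts_count:
  assumes "n \<ge> 1" "M \<in> contents n k" "\<And>i. i \<in> {2..n} \<Longrightarrow> f i = count M i"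
  shows "mset_of_counts n k f = M"
proof (rule multiset_eqI)
  fix j
  have k: "k = count M 1 + (\<Sum>i=2..n. count M i)"
    using assms(2) size_eq_sum_count[of M n] sum_split_first[OF assms(1), of "count M"]
    by (simp add: contents_def)
  have "(\<Sum>i=2..n. f i) = (\<Sum>i=2..n. count M i)" by (intro sum.cong refl assms(3))
  moreover have "count M j = 0" if "j \<notin> {1..n}"
    using assms(2) that by (auto simp: contents_def subset_iff simp flip: not_in_iff)
  moreover have "j \<in> {2..n} \<or> j = 1 \<or> j \<notin> {1..n}" by auto
  ultimately show "count (mset_of_counts n k f) j = count M j"
    using k assms(3) by (auto simp: count_mset_of_counts)
qed

text \<open>The multiplicities of each letter i \<ge> 2 in M and M' are chosen independently,
  subject to the difference prescribed by \<gamma>. Those of the letter 1 are then forced: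
  nonnegative since n B \<le> k, and with the right difference since \<gamma> has coordinate sum 0.
  So the sum factors over i.\<close>

lemma sum_root_pairs:
  assumes "n \<ge> 1" "n * B \<le> k" "\<gamma> \<in> bounded_roots n B"
  shows "(\<Sum>(M, M')\<in>root_pairs n k B \<gamma>. \<Prod>i=2..n. durfee_term (count M i) (count M' i)) =
           (\<Prod>i=2..n. \<Sum>(a, b) | a \<le> B \<and> b \<le> B \<and> int b - int a = Poly_Mapping.lookup \<gamma> i.
              durfee_term a b :: 'a::comm_ring_1 fps)"
proof -
  let ?S = "\<lambda>i. {(a, b). a \<le> B \<and> b \<le> B \<and> int b - int a = Poly_Mapping.lookup \<gamma> i}"
  let ?j = "\<lambda>(M, M'). \<lambda>i\<in>{2..n}. (count M i, count M' i)"
  let ?i = "\<lambda>p. (mset_of_counts n k (\<lambda>i. fst (p i)), mset_of_counts n k (\<lambda>i. snd (p i)))"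
  have fin: "finite (?S i)" for i
    by (rule finite_subset[of _ "{..B} \<times> {..B}"]) auto
  have bound: "(\<Sum>i=2..n. f i) \<le> k" if "\<And>i. i \<in> {2..n} \<Longrightarrow> f i \<le> B" for f
  proof -
    have "(\<Sum>i=2..n. f i) \<le> (\<Sum>i=2..n. B)" by (rule sum_mono) (use that in auto)
    also have "\<dots> \<le> n * B" by simp
    finally show ?thesis using assms(2) by simp
  qed
  have \<gamma>: "\<gamma> \<in> root_lattice n" using assms(3) by (simp add: bounded_roots_def)
  have "(\<Prod>i=2..n. \<Sum>s\<in>?S i. case_prod durfee_term s) =
      (\<Sum>p\<in>Pi\<^sub>E {2..n} ?S. \<Prod>i=2..n. case_prod durfee_term (p i) :: 'a fps)"
    by (rule prod_sum_PiE) (use fin in auto)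
  also have "\<dots> = (\<Sum>(M, M')\<in>root_pairs n k B \<gamma>. \<Prod>i=2..n. durfee_term (count M i) (count M' i))"
  proof (rule sum.reindex_bij_witness[where i = ?j and j = ?i])
    fix p assume p: "p \<in> Pi\<^sub>E {2..n} ?S"
    have pS: "fst (p i) \<le> B" "snd (p i) \<le> B"
      "int (snd (p i)) - int (fst (p i)) = Poly_Mapping.lookup \<gamma> i" if "i \<in> {2..n}" for i
      using PiE_mem[OF p that] by auto
    have le: "(\<Sum>i=2..n. fst (p i)) \<le> k" "(\<Sum>i=2..n. snd (p i)) \<le> k"
      by (intro bound pS; assumption)+
    show "?j (?i p) = p"
      using p by (auto simp: fun_eq_iff count_mset_of_counts PiE_def extensional_def)
    have "mvec (snd (?i p)) - mvec (fst (?i p)) = \<gamma>"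
    proof (rule poly_mapping_eqI)
      fix j
      have "(\<Sum>i=2..n. int (snd (p i)) - int (fst (p i))) = (\<Sum>i=2..n. Poly_Mapping.lookup \<gamma> i)"
        by (intro sum.cong refl pS)
      \<comment> \<open>This is coordinate 1; \<open>le\<close> keeps the subtractions from
        truncating.\<close>
      hence "int (k - (\<Sum>i=2..n. snd (p i))) - int (k - (\<Sum>i=2..n. fst (p i))) = Poly_Mapping.lookup \<gamma> 1"
        unfolding root_lattice_coord_1[OF assms(1) \<gamma>]
        using le by (simp add: of_nat_diff sum_subtractf)
      moreover have "Poly_Mapping.lookup \<gamma> j = 0" if "j \<notin> {1..n}"
        using \<gamma> that by (auto simp: root_lattice_def exp_lattice_def subset_iff Poly_Mapping.in_keys_iff)
      moreover have "j \<in> {2..n} \<or> j = 1 \<or> j \<notin> {1..n}" by auto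
      ultimately show "Poly_Mapping.lookup (mvec (snd (?i p)) - mvec (fst (?i p))) j = Poly_Mapping.lookup \<gamma> j"
        using pS(3)[of j] by (auto simp: lookup_minus lookup_mvec count_mset_of_counts)
    qed
    moreover have "fst (?i p) \<in> bounded_contents n k B" "snd (?i p) \<in> bounded_contents n k B"
      using mset_of_counts_contents[OF assms(1) le(1)] mset_of_counts_contents[OF assms(1) le(2)] pS
      by (auto simp: bounded_contents_def count_mset_of_counts)
    ultimately show "?i p \<in> root_pairs n k B \<gamma>" by (simp add: root_pairs_def)
    show "(case ?i p of (M, M') \<Rightarrow> \<Prod>i=2..n. durfee_term (count M i) (count M' i)) =
        (\<Prod>i=2..n. case_prod durfee_term (p i) :: 'a fps)"
      by (auto simp: count_mset_of_counts case_prod_unfold intro!: prod.cong)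
  next
    fix s assume s: "s \<in> root_pairs n k B \<gamma>"
    obtain M M' where MM: "s = (M, M')" by (cases s)
    have M: "M \<in> bounded_contents n k B" "M' \<in> bounded_contents n k B" "mvec M' - mvec M = \<gamma>"
      using s by (simp_all add: MM root_pairs_def)
    have "Poly_Mapping.lookup \<gamma> i = int (count M' i) - int (count M i)" for i
      unfolding M(3)[symmetric] by (simp add: lookup_minus lookup_mvec)
    thus "?j s \<in> Pi\<^sub>E {2..n} ?S"
      using M by (auto simp: MM bounded_contents_def)
    have "mset_of_counts n k (\<lambda>i. fst (?j s i)) = M" "mset_of_counts n k (\<lambda>i. snd (?j s i)) = M'"
      by (rule mset_of_counts_count; use assms(1) M in \<open>simp add: MM bounded_contents_def\<close>)+
    thus "?i (?j s) = s" by (simp add: MM)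
  qed
  finally show ?thesis by simp
qed

text \<open>The bound on k ensures that the letter 1 occurs at least N times in every bounded
  content.\<close>

lemma fps_cong_word_series:
  assumes n: "n \<ge> 1" and B: "2 * N \<le> B" and k: "n * B + N \<le> k"
  shows "fps_cong N (word_series n k) (chi n)"
proof -
  let ?T = "\<lambda>M M'. fps_const (x_pow (mvec M' - mvec M)) * fps_X ^ content_exp n M M' * qmult n M * qmult n M'"
  let ?b = "bounded_contents n k B"
  let ?D = "\<lambda>M M'. \<Prod>i=2..n. durfee_term (count M i) (count M' i) :: laurent_poly fps"
  let ?W = "\<lambda>\<gamma>. fps_const (x_pow \<gamma>) * fps_X ^ theta_exp n \<gamma>"
  have bsub: "?b \<subseteq> contents n k" by (auto simp: bounded_contents_def)
  hence finb: "finite ?b" using finite_contents by (rule finite_subset)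
  have T0: "fps_cong N (?T M M') 0"
    if "M \<in> contents n k" "M' \<in> contents n k" "M \<notin> ?b \<or> M' \<notin> ?b" for M M'
    using fps_cong_X_power_mult[OF content_exp_ge[OF n that(1,2) B that(3)],
        of "fps_const (x_pow (mvec M' - mvec M)) * (qmult n M * qmult n M')"]
    by (simp only: mult_ac)
  have T: "fps_cong N (?T M M') (?W (mvec M' - mvec M) * ?D M M')" if M: "M \<in> ?b" "M' \<in> ?b" for M M'
  proof -
    have "fps_cong N (?T M M') (fps_const (x_pow (mvec M' - mvec M)) * fps_X ^ content_exp n M M' *
        (\<Prod>i=2..n. inv_qpoch (count M i)) * (\<Prod>i=2..n. inv_qpoch (count M' i)))"
      by (intro fps_cong_mult fps_cong_refl fps_cong_qmult[OF n k] M)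
    also have "\<dots> = ?W (mvec M' - mvec M) * ?D M M'"
      using M bsub by (subst content_exp_eq_theta_exp[OF n])
        (auto simp: durfee_term_def prod.distrib power_add power_sum mult_ac)
    finally show ?thesis .
  qed
  have word: "word_series n k = (\<Sum>(M, M')\<in>contents n k \<times> contents n k. ?T M M')"
    unfolding word_series_contents[OF n] by (simp add: sum.cartesian_product)
  \<comment> \<open>Pairs outside the bounds are first replaced by 0, so that both sums share an
    index set and compare termwise.\<close>
  have cong: "fps_cong N (\<Sum>(M, M')\<in>contents n k \<times> contents n k. ?T M M')
      (\<Sum>(M, M')\<in>contents n k \<times> contents n k.
        if M \<in> ?b \<and> M' \<in> ?b then ?W (mvec M' - mvec M) * ?D M M' else 0)"
    by (intro fps_cong_sum) (use T T0 in auto)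
  have "(\<Sum>(M, M')\<in>contents n k \<times> contents n k.
        if M \<in> ?b \<and> M' \<in> ?b then ?W (mvec M' - mvec M) * ?D M M' else 0) =
      (\<Sum>(M, M')\<in>?b \<times> ?b. ?W (mvec M' - mvec M) * ?D M M')"
    by (rule sum.mono_neutral_cong_right) (use bsub in \<open>auto split: if_splits\<close>)
  also have "\<dots> = (\<Sum>\<gamma>\<in>bounded_roots n B. \<Sum>(M, M')\<in>{s \<in> ?b \<times> ?b. (case s of (M, M') \<Rightarrow> mvec M' - mvec M) = \<gamma>}.
      ?W (mvec M' - mvec M) * ?D M M')"
  proof (rule sum.group[symmetric])
    have "mvec M' - mvec M \<in> bounded_roots n B" if "M \<in> ?b" "M' \<in> ?b" for M M'
    proof -
      have "\<bar>int (count M' i) - int (count M i)\<bar> \<le> int B" if "i \<in> {2..n}" for i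
        using \<open>M \<in> ?b\<close> \<open>M' \<in> ?b\<close> that
        by (auto simp: bounded_contents_def abs_le_iff)
          (smt (verit) of_nat_le_iff of_nat_0_le_iff atLeastAtMost_iff)+
      thus ?thesis
        using mvec_diff_root_lattice[of M n k M'] that bsub
        by (auto simp: bounded_roots_def lookup_minus lookup_mvec)
    qed
    thus "(\<lambda>(M, M'). mvec M' - mvec M) ` (?b \<times> ?b) \<subseteq> bounded_roots n B" by auto
  qed (use finb n in auto)
  also have "\<dots> = (\<Sum>\<gamma>\<in>bounded_roots n B. ?W \<gamma> * (\<Sum>(M, M')\<in>root_pairs n k B \<gamma>. ?D M M'))"
  proof (rule sum.cong[OF refl])
    fix \<gamma> assume "\<gamma> \<in> bounded_roots n B"
    have "{s \<in> ?b \<times> ?b. (case s of (M, M') \<Rightarrow> mvec M' - mvec M) = \<gamma>} = root_pairs n k B \<gamma>"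
      by (auto simp: root_pairs_def)
    thus "(\<Sum>(M, M')\<in>{s \<in> ?b \<times> ?b. (case s of (M, M') \<Rightarrow> mvec M' - mvec M) = \<gamma>}.
        ?W (mvec M' - mvec M) * ?D M M') = ?W \<gamma> * (\<Sum>(M, M')\<in>root_pairs n k B \<gamma>. ?D M M')"
      by (auto simp: root_pairs_def sum_distrib_left intro!: sum.cong)
  qed
  finally have "fps_cong N (word_series n k)
      (\<Sum>\<gamma>\<in>bounded_roots n B. ?W \<gamma> * (\<Sum>(M, M')\<in>root_pairs n k B \<gamma>. ?D M M'))"
    using cong unfolding word by (simp only:)
  moreover have "fps_cong N
      (\<Sum>\<gamma>\<in>bounded_roots n B. ?W \<gamma> * (\<Sum>(M, M')\<in>root_pairs n k B \<gamma>. ?D M M'))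
      (\<Sum>\<gamma>\<in>bounded_roots n B. ?W \<gamma> * inv_qpoch N ^ (n - 1))"
  proof (intro fps_cong_sum fps_cong_mult fps_cong_refl)
    fix \<gamma> assume \<gamma>: "\<gamma> \<in> bounded_roots n B"
    \<comment> \<open>Each coordinate from 2 to n supplies one Durfee sum, hence n - 1 factors
      1/(q)_N.\<close>
    have "fps_cong N (\<Prod>i=2..n. \<Sum>(a, b) | a \<le> B \<and> b \<le> B \<and> int b - int a = Poly_Mapping.lookup \<gamma> i.
        durfee_term a b) (\<Prod>i=2..n. inv_qpoch N :: laurent_poly fps)"
      by (intro fps_cong_prod durfee_rectangle_cong)
        (use B \<gamma> in \<open>auto simp: bounded_roots_def\<close>)
    moreover have "n * B \<le> k" using k by simp
    ultimately show "fps_cong N (\<Sum>(M, M')\<in>root_pairs n k B \<gamma>. ?D M M') (inv_qpoch N ^ (n - 1))"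
      using sum_root_pairs[OF n _ \<gamma>, of k, where 'a = laurent_poly] by simp
  qed
  moreover have "fps_cong N (\<Sum>\<gamma>\<in>bounded_roots n B. ?W \<gamma> * inv_qpoch N ^ (n - 1))
      (Theta n * inv_qpoch N ^ (n - 1))"
    unfolding sum_distrib_right[symmetric]
    by (intro fps_cong_mult fps_cong_refl fps_cong_sym[OF fps_cong_Theta_bounded_roots[OF n B]])
  moreover have "fps_cong N (Theta n * inv_qpoch N ^ (n - 1)) (chi n)"
    by (rule fps_cong_sym[OF fps_cong_chi])
  ultimately show ?thesis by (blast intro: fps_cong_trans)
qed


subsection \<open>Fillings as pairs of words\<close>

text \<open>Entry r of the strictly increasing column that omits a from {1..n}.\<close>

definition skip_col :: "nat \<Rightarrow> nat \<Rightarrow> nat" where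
  "skip_col a r = (if r < a then r else r + 1)"

text \<open>Distinct a and a' are told apart in row r = min a a', where one column has the entry r +
  1 and the other still r.\<close>

lemma skip_col_inj:
  assumes "a \<in> {1..n}" "a' \<in> {1..n}" "\<And>r. r \<in> {1..n - 1} \<Longrightarrow> skip_col a r = skip_col a' r"
  shows "a = a'"
proof (rule ccontr)
  assume "a \<noteq> a'"
  hence "min a a' \<in> {1..n - 1}" using assms(1,2) by auto
  from assms(3)[OF this] show False using \<open>a \<noteq> a'\<close> by (auto simp: skip_col_def min_def split: if_splits)
qed

text \<open>Induction on the height. A bottom entry equal to its row number forces all entries to
  equal theirs, and the largest value is missing. Otherwise the bottom entry is the largest value,
  and the missing one comes from the rows above.\<close>

lemma skip_col_exists:
  fixes f :: "nat \<Rightarrow> nat"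
  assumes "\<And>r. r \<in> {1..m} \<Longrightarrow> f r \<in> {1..Suc m}"
    and "\<And>r r'. r \<in> {1..m} \<Longrightarrow> r' \<in> {1..m} \<Longrightarrow> r < r' \<Longrightarrow> f r < f r'"
  shows "\<exists>a\<in>{1..Suc m}. \<forall>r\<in>{1..m}. f r = skip_col a r"
  using assms
proof (induction m)
  case 0
  thus ?case by simp
next
  case (Suc m)
  note range = Suc.prems(1) and strict = Suc.prems(2)
  have ge: "r \<le> f r" if "r \<in> {1..Suc m}" for r
    using that
  proof (induction r)
    case (Suc r)
    show ?case
    proof (cases "r = 0")
      case True
      thus ?thesis using range[of 1] by simp
    next
      case False
      hence "r \<le> f r" using Suc by simp
      moreover have "f r < f (Suc r)" using Suc.prems False by (intro strict) auto
      ultimately show ?thesis by simp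
    qed
  qed simp
  show ?case
  proof (cases "f (Suc m) = Suc m")
    case True
    have "f r = r" if "r \<in> {1..Suc m}" for r
    proof -
      have "j \<le> m \<Longrightarrow> f (Suc m - j) \<le> Suc m - j" for j
      proof (induction j)
        case 0
        thus ?case using True by simp
      next
        case (Suc j)
        have "f (Suc m - Suc j) < f (Suc m - j)" using Suc.prems by (intro strict) auto
        thus ?case using Suc by simp
      qed
      from this[of "Suc m - r"] have "f r \<le> r" using that by auto
      with ge[OF that] show ?thesis by simp
    qed
    hence "\<forall>r\<in>{1..Suc m}. f r = skip_col (Suc (Suc m)) r" by (simp add: skip_col_def)
    thus ?thesis by (intro bexI[of _ "Suc (Suc m)"]) auto
  next
    case False
    hence top: "f (Suc m) = Suc (Suc m)"
      using ge[of "Suc m"] range[of "Suc m"] by simp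
    have "\<exists>a\<in>{1..Suc m}. \<forall>r\<in>{1..m}. f r = skip_col a r"
    proof (rule Suc.IH)
      fix r assume r: "r \<in> {1..m}"
      hence "f r < f (Suc m)" by (intro strict) auto
      thus "f r \<in> {1..Suc m}" using top range[of r] r by auto
    qed (use strict in auto)
    then obtain a where a: "a \<in> {1..Suc m}" "\<forall>r\<in>{1..m}. f r = skip_col a r" by blast
    have "f r = skip_col a r" if "r \<in> {1..Suc m}" for r
      using that a top by (cases "r = Suc m") (auto simp: skip_col_def)
    thus ?thesis using a(1) by (intro bexI[of _ a]) auto
  qed
qed

text \<open>
  The contribution of two columns to \<^const>\<open>inv_stat\<close> before the arms are subtracted; the arms
  account for exactly the summand \<open>n - 2\<close>.
\<close>

lemma skip_col_inversions:
  assumes "n \<ge> 2" "a \<in> {1..n}" "b \<in> {1..n}"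
  shows "(\<Sum>r=1..n - 1. of_bool (skip_col b r < skip_col a r)) +
         (\<Sum>r=2..n - 1. of_bool (skip_col a (r - 1) < skip_col b r)) =
         int (n - 2) + of_bool (a < b)"
proof -
  \<comment> \<open>The inequality says that in row r the column omitting a has passed its gap and
    the one omitting b has not.\<close>
  have "{r \<in> {1..n - 1}. skip_col b r < skip_col a r} = {a..<b}"
    using assms by (auto simp: skip_col_def split: if_splits)
  hence 1: "(\<Sum>r=1..n - 1. of_bool (skip_col b r < skip_col a r)) = int (b - a)"
    by (simp add: sum.If_cases of_bool_def Int_def)
  \<comment> \<open>The inequality fails only if the column omitting a has passed its gap in row r -
    1 and the one omitting b has not in row r; then both entries are r.\<close>
  have "{r \<in> {2..n - 1}. skip_col a (r - 1) < skip_col b r} = {2..n - 1} - {a + 1..<b}"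
    using assms by (auto simp: skip_col_def split: if_splits)
  moreover have "{a + 1..<b} \<subseteq> {2..n - 1}" using assms by auto
  ultimately have "card {r \<in> {2..n - 1}. skip_col a (r - 1) < skip_col b r} = (n - 2) - (b - (a + 1))"
    using assms(1) by (simp add: card_Diff_subset)
  hence 2: "(\<Sum>r=2..n - 1. of_bool (skip_col a (r - 1) < skip_col b r)) = int ((n - 2) - (b - (a + 1)))"
    by (simp add: sum.If_cases of_bool_def Int_def)
  \<comment> \<open>The truncated differences b - a and b - (a + 1) differ by one if a < b and both
    vanish otherwise.\<close>
  show ?thesis unfolding 1 2 using assms by auto
qed

section \<open>The diagram of \<open>k_theta\<close> and its fillings\<close>

lemma dg_k_theta:
  assumes "n \<ge> 2"
  shows "dg (k_theta n k) = {1..n - 1} \<times> {1..k} \<union> {1} \<times> {k<..2 * k}"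
proof -
  have nth: "k_theta n k ! (r - 1) = (if r = 1 then 2 * k else if r \<le> n - 1 then k else 0)"
    if "1 \<le> r" "r \<le> n" for r
    using that assms by (auto simp: k_theta_def theta_def nth_Cons' nth_append)
  have len: "length (k_theta n k) = n" using assms by (simp add: k_theta_def theta_def)
  have "(r, c) \<in> dg (k_theta n k) \<longleftrightarrow>
      1 \<le> r \<and> r \<le> n \<and> 1 \<le> c \<and> c \<le> (if r = 1 then 2 * k else if r \<le> n - 1 then k else 0)" for r c
    using nth[of r] len by (cases "1 \<le> r \<and> r \<le> n") (auto simp: dg_def)
  thus ?thesis using assms by (auto split: if_splits)
qed

lemma sum_dg_k_theta:
  assumes "n \<ge> 2"
  shows "(\<Sum>u\<in>dg (k_theta n k). f u) =
           (\<Sum>i<k. \<Sum>r=1..n - 1. f (r, Suc i)) + (\<Sum>i<k. f (1, 2 * k - i))"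
proof -
  have "(\<Sum>u\<in>dg (k_theta n k). f u) =
      (\<Sum>u\<in>{1..n - 1} \<times> {1..k}. f u) + (\<Sum>u\<in>{1} \<times> {k<..2 * k}. f u)"
    unfolding dg_k_theta[OF assms] by (rule sum.union_disjoint) auto
  also have "(\<Sum>u\<in>{1..n - 1} \<times> {1..k}. f u) = (\<Sum>c=1..k. \<Sum>r=1..n - 1. f (r, c))"
    by (subst sum.swap) (simp add: sum.cartesian_product)
  also have "\<dots> = (\<Sum>i<k. \<Sum>r=1..n - 1. f (r, Suc i))"
    by (simp add: sum.atLeast1_atMost_eq)
  also have "(\<Sum>u\<in>{1} \<times> {k<..2 * k}. f u) = (\<Sum>i<k. f (1, 2 * k - i))"
    by (rule sum.reindex_bij_witness[where j = "\<lambda>u. 2 * k - snd u" and i = "\<lambda>i. (1, 2 * k - i)"]) auto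
  finally show ?thesis .
qed

text \<open>
  The letters of \<open>a\<close> are the entries missing from the long columns, from left to right; the letters
  of \<open>b\<close> are the entries of the single cells, from right to left.
\<close>

definition word_filling :: "nat \<Rightarrow> nat \<Rightarrow> nat list \<times> nat list \<Rightarrow> nat \<times> nat \<Rightarrow> nat" where
  "word_filling n k = (\<lambda>(a, b). \<lambda>(r, c)\<in>dg (k_theta n k).
     if c \<le> k then skip_col (a ! (c - 1)) r else b ! (2 * k - c))"

lemma word_filling_long:
  assumes "n \<ge> 2" "i < k" "r \<in> {1..n - 1}"
  shows "word_filling n k (a, b) (r, Suc i) = skip_col (a ! i) r"
  using assms by (auto simp: word_filling_def dg_k_theta)

lemma word_filling_short:
  assumes "n \<ge> 2" "i < k"
  shows "word_filling n k (a, b) (1, 2 * k - i) = b ! i"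
  using assms by (auto simp: word_filling_def dg_k_theta)

lemma nth_words: "w \<in> words n k \<Longrightarrow> i < k \<Longrightarrow> w ! i \<in> {1..n}"
  by (auto simp: words_def subset_iff)

lemma word_filling_col_strict:
  assumes n: "n \<ge> 2" and a: "a \<in> words n k" and b: "b \<in> words n k"
  shows "word_filling n k (a, b) \<in> col_strict_fillings n (k_theta n k)"
proof -
  have "word_filling n k (a, b) u \<in> {1..n}" if "u \<in> dg (k_theta n k)" for u
  proof -
    obtain r c where u: "u = (r, c)" by (cases u)
    show ?thesis
    proof (cases "c \<le> k")
      case True
      hence c: "c = Suc (c - 1)" "c - 1 < k" "r \<in> {1..n - 1}"
        using that n by (auto simp: u dg_k_theta)
      have "word_filling n k (a, b) u = skip_col (a ! (c - 1)) r"
        unfolding u using word_filling_long[OF n c(2,3), of a b] c(1) by simp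
      thus ?thesis using c(3) by (auto simp: skip_col_def)
    next
      case False
      hence c: "c = 2 * k - (2 * k - c)" "2 * k - c < k" "r = 1"
        using that n by (auto simp: u dg_k_theta)
      have "word_filling n k (a, b) u = b ! (2 * k - c)"
        unfolding u using word_filling_short[OF n c(2), of a b] c(1,3) by simp
      thus ?thesis using nth_words[OF b c(2)] by simp
    qed
  qed
  moreover have "word_filling n k (a, b) (r, c) < word_filling n k (a, b) (r', c)"
    if "(r, c) \<in> dg (k_theta n k)" "(r', c) \<in> dg (k_theta n k)" "r < r'" for r r' c
  proof -
    have c: "c = Suc (c - 1)" "c - 1 < k" "r \<in> {1..n - 1}" "r' \<in> {1..n - 1}"
      using that n by (auto simp: dg_k_theta)
    show ?thesis
      using word_filling_long[OF n c(2,3), of a b] word_filling_long[OF n c(2,4), of a b] c(1) that(3)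
      by (auto simp: skip_col_def)
  qed
  ultimately show ?thesis
    by (auto simp: col_strict_fillings_def word_filling_def)
qed

text \<open>For surjectivity, \<open>skip_col_exists\<close> recovers the missing entry of every
  long column; the single cells are unrestricted.\<close>

lemma bij_betw_word_filling:
  assumes n: "n \<ge> 2"
  shows "bij_betw (word_filling n k) (words n k \<times> words n k) (col_strict_fillings n (k_theta n k))"
  unfolding bij_betw_def
proof
  show "inj_on (word_filling n k) (words n k \<times> words n k)"
  proof (rule inj_onI)
    fix s t assume s: "s \<in> words n k \<times> words n k" and t: "t \<in> words n k \<times> words n k"
      and eq: "word_filling n k s = word_filling n k t"
    obtain a b where ab: "s = (a, b)" by (cases s)
    obtain a' b' where ab': "t = (a', b')" by (cases t)
    have w: "a \<in> words n k" "b \<in> words n k" "a' \<in> words n k" "b' \<in> words n k"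
      using s t by (simp_all add: ab ab')
    have "a ! i = a' ! i" if "i < k" for i
    proof (rule skip_col_inj)
      fix r assume "r \<in> {1..n - 1}"
      thus "skip_col (a ! i) r = skip_col (a' ! i) r"
        using word_filling_long[OF n that] fun_cong[OF eq[unfolded ab ab'], of "(r, Suc i)"] by metis
    qed (use w that nth_words in blast)+
    moreover have "b ! i = b' ! i" if "i < k" for i
      using word_filling_short[OF n that] fun_cong[OF eq[unfolded ab ab'], of "(1, 2 * k - i)"] by metis
    ultimately show "s = t" using w by (auto simp: ab ab' words_def intro!: nth_equalityI)
  qed
  show "word_filling n k ` (words n k \<times> words n k) = col_strict_fillings n (k_theta n k)"
  proof
    show "word_filling n k ` (words n k \<times> words n k) \<subseteq> col_strict_fillings n (k_theta n k)"
      using word_filling_col_strict[OF n] by auto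
    show "col_strict_fillings n (k_theta n k) \<subseteq> word_filling n k ` (words n k \<times> words n k)"
    proof
      fix F assume F: "F \<in> col_strict_fillings n (k_theta n k)"
      have range: "F u \<in> {1..n}" if "u \<in> dg (k_theta n k)" for u
        using F that by (auto simp: col_strict_fillings_def)
      have strict: "F (r, c) < F (r', c)"
        if "(r, c) \<in> dg (k_theta n k)" "(r', c) \<in> dg (k_theta n k)" "r < r'" for r r' c
        using F that by (auto simp: col_strict_fillings_def)
      have "\<exists>x\<in>{1..n}. \<forall>r\<in>{1..n - 1}. F (r, Suc i) = skip_col x r" if "i < k" for i
      proof -
        have "r \<in> {1..n - 1} \<Longrightarrow> (r, Suc i) \<in> dg (k_theta n k)" for r
          using that n by (auto simp: dg_k_theta)
        moreover have "Suc (n - 1) = n" using n by simp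
        ultimately show ?thesis
          using skip_col_exists[of "n - 1" "\<lambda>r. F (r, Suc i)"] range strict by metis
      qed
      then obtain x where x: "\<And>i. i < k \<Longrightarrow> x i \<in> {1..n}"
        "\<And>i r. i < k \<Longrightarrow> r \<in> {1..n - 1} \<Longrightarrow> F (r, Suc i) = skip_col (x i) r"
        by metis
      define a b where "a = map x [0..<k]" and "b = map (\<lambda>i. F (1, 2 * k - i)) [0..<k]"
      have "(1, 2 * k - i) \<in> dg (k_theta n k)" if "i < k" for i
        using that n by (auto simp: dg_k_theta)
      hence ab: "a \<in> words n k" "b \<in> words n k"
        using x(1) range by (auto simp: words_def a_def b_def simp del: atLeastAtMost_iff)
      have "word_filling n k (a, b) u = F u" for u
      proof (cases "u \<in> dg (k_theta n k)")
        case False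
        hence "F u = undefined"
          using F by (auto simp: col_strict_fillings_def intro: PiE_arb)
        thus ?thesis using False by (simp add: word_filling_def)
      next
        case True
        obtain r c where u: "u = (r, c)" by (cases u)
        show ?thesis
        proof (cases "c \<le> k")
          case c: True
          hence "c - 1 < k" "r \<in> {1..n - 1}" "Suc (c - 1) = c"
            using True n by (auto simp: u dg_k_theta)
          thus ?thesis using x(2)[of "c - 1" r] True c
            by (simp add: u word_filling_def a_def)
        next
          case False
          hence "2 * k - c < k" "r = 1" "2 * k - (2 * k - c) = c"
            using True n by (auto simp: u dg_k_theta)
          thus ?thesis using True False by (simp add: u word_filling_def b_def)
        qed
      qed
      hence "F = word_filling n k (a, b)" by auto
      thus "F \<in> word_filling n k ` (words n k \<times> words n k)" using ab by blast
    qed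
  qed
qed

lemma word_filling_in_C_fillings_iff:
  assumes n: "n \<ge> 2" and a: "a \<in> words n k" and b: "b \<in> words n k"
  shows "word_filling n k (a, b) \<in> C_fillings n k \<longleftrightarrow> \<not> (k > 0 \<and> a ! 0 = 1 \<and> b ! 0 = 1)"
proof (cases "k = 0")
  case True
  hence "dg (k_theta n k) = {}" using n by (auto simp: dg_k_theta)
  thus ?thesis using True word_filling_col_strict[OF assms]
    by (simp add: C_fillings_def occurs_in_column_def)
next
  case False
  hence k: "0 < k" by simp
  have "occurs_in_column (k_theta n k) (word_filling n k (a, b)) 1 1 \<longleftrightarrow>
      (\<exists>r\<in>{1..n - 1}. word_filling n k (a, b) (r, Suc 0) = 1)"
    using k n by (auto simp: occurs_in_column_def dg_k_theta)
  also have "\<dots> \<longleftrightarrow> (\<exists>r\<in>{1..n - 1}. skip_col (a ! 0) r = 1)"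
    using word_filling_long[OF n k] by simp
  also have "\<dots> \<longleftrightarrow> a ! 0 \<noteq> 1"
    using n nth_words[OF a k] by (auto simp: skip_col_def intro!: bexI[of _ 1])
  finally have first: "occurs_in_column (k_theta n k) (word_filling n k (a, b)) 1 1 \<longleftrightarrow> a ! 0 \<noteq> 1" .
  have "hd (k_theta n k) = 2 * k" by (simp add: k_theta_def theta_def)
  moreover have "(r, 2 * k) \<in> dg (k_theta n k) \<longleftrightarrow> r = 1" for r
    using k n by (auto simp: dg_k_theta)
  ultimately have "occurs_in_column (k_theta n k) (word_filling n k (a, b)) 1 (hd (k_theta n k)) \<longleftrightarrow> b ! 0 = 1"
    using word_filling_short[OF n k, of a b] by (simp add: occurs_in_column_def)
  with first show ?thesis
    using word_filling_col_strict[OF assms] k by (auto simp: C_fillings_def)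
qed

section \<open>The inversion statistic of a filling\<close>

lemma length_filter_conv_sum:
  "int (length (filter P w)) = (\<Sum>i<length w. of_bool (P (w ! i)))"
  by (induction w) (simp_all add: sum.lessThan_Suc_shift del: sum.lessThan_Suc)

lemma sum_of_bool_less: "(\<Sum>i<k. \<Sum>j<k. of_bool (i < j)) = int (k choose 2)"
proof (induction k)
  case (Suc k)
  have "(\<Sum>i<Suc k. \<Sum>j<Suc k. of_bool (i < j)) =
      (\<Sum>i<k. (\<Sum>j<k. of_bool (i < j)) + of_bool (i < k)) + (\<Sum>j<Suc k. of_bool (k < j) :: int)"
    by (simp del: sum_of_bool_eq)
  also have "(\<Sum>j<Suc k. of_bool (k < j) :: int) = 0" by (intro sum.neutral) auto
  also have "(\<Sum>i<k. (\<Sum>j<k. of_bool (i < j)) + of_bool (i < k)) = int (k choose 2) + int k"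
    unfolding sum.distrib Suc.IH by simp
  finally show ?case by (simp add: numeral_2_eq_2)
qed (simp add: numeral_2_eq_2)

text \<open>Every pair of positions is either a strict ascent or a weak inversion.\<close>

lemma sum_ascents:
  "(\<Sum>i<length w. \<Sum>j<length w. of_bool (i < j) * of_bool (w ! i < w ! j)) =
     int (length w choose 2) - int (weak_inv w)"
proof (induction w)
  case (Cons c w)
  let ?k = "length w"
  have "(\<Sum>i<length (c # w). \<Sum>j<length (c # w). of_bool (i < j) * of_bool ((c # w) ! i < (c # w) ! j)) =
      (\<Sum>j<?k. of_bool (c < w ! j)) +
      (\<Sum>i<?k. \<Sum>j<?k. of_bool (i < j) * of_bool (w ! i < w ! j) :: int)"
    by (simp add: sum.lessThan_Suc_shift del: sum.lessThan_Suc)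
  also have "(\<Sum>j<?k. of_bool (c < w ! j) :: int) = int ?k - int (length (filter (\<lambda>x. x \<le> c) w))"
  proof -
    have "(\<Sum>j<?k. of_bool (c < w ! j) :: int) = (\<Sum>j<?k. 1 - of_bool (w ! j \<le> c))"
      by (intro sum.cong) auto
    thus ?thesis by (simp add: length_filter_conv_sum sum_subtractf)
  qed
  finally show ?case unfolding Cons.IH by (simp add: numeral_2_eq_2)
qed (simp add: numeral_2_eq_2)

lemma sum_of_bool_eq_1: "(\<Sum>i<length w. of_bool (w ! i = x)) = int (count (mset w) x)"
  by (induction w) (simp_all add: sum.lessThan_Suc_shift del: sum.lessThan_Suc)

text \<open>Attacking pairs are sorted by whether each cell lies in a long column or is a single
  cell. Two long columns i < j give n - 2, plus 1 at an ascent of a; a long column and a single cell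
  interact only through letters 1; two single cells give the ascents of b.\<close>

lemma card_Inv_set_word_filling:
  assumes n: "n \<ge> 2" and a: "a \<in> words n k" and b: "b \<in> words n k"
  shows "int (card (Inv_set (k_theta n k) (word_filling n k (a, b)))) =
    int (n - 2) * int (k choose 2) + (int (k choose 2) - int (weak_inv a)) +
    int (count (mset a) 1) * int (count (mset b) 1) + (int (k choose 2) - int (weak_inv b))"
proof -
  define F where "F = word_filling n k (a, b)"
  let ?dg = "dg (k_theta n k)"
  define t :: "nat \<times> nat \<Rightarrow> nat \<times> nat \<Rightarrow> int"
    where "t u v = of_bool (Inv_attacks u v \<and> F u > F v)" for u v
  have len: "length a = k" "length b = k" using a b by (simp_all add: words_def)
  have Flong: "F (r, Suc i) = skip_col (a ! i) r" if "i < k" "r \<in> {1..n - 1}" for i r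
    unfolding F_def by (rule word_filling_long[OF n that])
  have Fshort: "F (1, 2 * k - i) = b ! i" if "i < k" for i
    unfolding F_def by (rule word_filling_short[OF n that])
  have "int (card (Inv_set (k_theta n k) F)) = (\<Sum>p\<in>?dg \<times> ?dg. of_bool (p \<in> Inv_set (k_theta n k) F))"
  proof -
    have "Inv_set (k_theta n k) F \<inter> ?dg \<times> ?dg = Inv_set (k_theta n k) F" by (auto simp: Inv_set_def)
    thus ?thesis
      using finite_dg[of "k_theta n k"] by (simp add: of_bool_def sum.If_cases Int_commute)
  qed
  also have "\<dots> = (\<Sum>u\<in>?dg. \<Sum>v\<in>?dg. t u v)"
    unfolding sum.cartesian_product by (intro sum.cong) (auto simp: t_def Inv_set_def)
  also have "\<dots> = (\<Sum>i<k. \<Sum>r=1..n - 1. \<Sum>j<k. \<Sum>r'=1..n - 1. t (r, Suc i) (r', Suc j)) +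
      (\<Sum>i<k. \<Sum>r=1..n - 1. \<Sum>j<k. t (r, Suc i) (1, 2 * k - j)) +
      (\<Sum>i<k. \<Sum>j<k. \<Sum>r'=1..n - 1. t (1, 2 * k - i) (r', Suc j)) +
      (\<Sum>i<k. \<Sum>j<k. t (1, 2 * k - i) (1, 2 * k - j))"
    unfolding sum_dg_k_theta[OF n] sum.distrib by (simp only: add_ac)
  also have "(\<Sum>i<k. \<Sum>r=1..n - 1. \<Sum>j<k. \<Sum>r'=1..n - 1. t (r, Suc i) (r', Suc j)) =
      int (n - 2) * int (k choose 2) + (int (k choose 2) - int (weak_inv a))"
  proof -
    define S1 where "S1 i j = (\<Sum>r=1..n - 1. of_bool (skip_col (a ! j) r < skip_col (a ! i) r) :: int)" for i j
    define S2 where "S2 i j = (\<Sum>r=2..n - 1. of_bool (skip_col (a ! j) (r - 1) < skip_col (a ! i) r) :: int)" for i j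
    \<comment> \<open>For i < j only cells in the same row attack; for j < i only a cell one row
      below its target does.\<close>
    have inner: "(\<Sum>r=1..n - 1. \<Sum>r'=1..n - 1. t (r, Suc i) (r', Suc j)) =
        of_bool (i < j) * S1 i j + of_bool (j < i) * S2 i j" if ij: "i < k" "j < k" for i j
    proof (cases i j rule: linorder_cases)
      case less
      have "(\<Sum>r'=1..n - 1. t (r, Suc i) (r', Suc j)) = of_bool (skip_col (a ! j) r < skip_col (a ! i) r)"
        if r: "r \<in> {1..n - 1}" for r
      proof -
        have "(\<Sum>r'=1..n - 1. t (r, Suc i) (r', Suc j)) =
            (\<Sum>r'=1..n - 1. if r = r' then of_bool (skip_col (a ! j) r < skip_col (a ! i) r) else 0)"
          by (intro sum.cong refl) (use less ij r in \<open>auto simp: t_def Inv_attacks_def Flong\<close>)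
        thus ?thesis using r by simp
      qed
      thus ?thesis using less by (simp add: S1_def)
    next
      case equal
      thus ?thesis by (simp add: t_def Inv_attacks_def)
    next
      case greater
      have "(\<Sum>r'=1..n - 1. t (r, Suc i) (r', Suc j)) =
          (if r \<in> {2..n - 1} then of_bool (skip_col (a ! j) (r - 1) < skip_col (a ! i) r) else 0)"
        if r: "r \<in> {1..n - 1}" for r
      proof -
        have "(\<Sum>r'=1..n - 1. t (r, Suc i) (r', Suc j)) =
            (\<Sum>r'=1..n - 1. if r - 1 = r' then of_bool (skip_col (a ! j) (r - 1) < skip_col (a ! i) r) else 0)"
          by (intro sum.cong refl) (use greater ij r in \<open>auto simp: t_def Inv_attacks_def Flong\<close>)
        thus ?thesis using r by auto
      qed
      hence "(\<Sum>r=1..n - 1. \<Sum>r'=1..n - 1. t (r, Suc i) (r', Suc j)) =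
          (\<Sum>r=1..n - 1. if r \<in> {2..n - 1} then of_bool (skip_col (a ! j) (r - 1) < skip_col (a ! i) r) else 0)"
        by (intro sum.cong refl)
      also have "\<dots> = S2 i j"
        unfolding S2_def by (rule sum.mono_neutral_cong_right) auto
      finally show ?thesis using greater by simp
    qed
    have "(\<Sum>i<k. \<Sum>r=1..n - 1. \<Sum>j<k. \<Sum>r'=1..n - 1. t (r, Suc i) (r', Suc j)) =
        (\<Sum>i<k. \<Sum>j<k. \<Sum>r=1..n - 1. \<Sum>r'=1..n - 1. t (r, Suc i) (r', Suc j))"
      by (intro sum.cong refl sum.swap)
    also have "\<dots> = (\<Sum>i<k. \<Sum>j<k. of_bool (i < j) * S1 i j) + (\<Sum>i<k. \<Sum>j<k. of_bool (j < i) * S2 i j)"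
      unfolding sum.distrib[symmetric] by (intro sum.cong refl) (simp only: inner lessThan_iff)
    \<comment> \<open>Exchanging i and j unites the two contributions of a pair of columns, as
      \<open>skip_col_inversions\<close> requires.\<close>
    also have "(\<Sum>i<k. \<Sum>j<k. of_bool (j < i) * S2 i j) = (\<Sum>i<k. \<Sum>j<k. of_bool (i < j) * S2 j i)"
      by (rule sum.swap)
    also have "(\<Sum>i<k. \<Sum>j<k. of_bool (i < j) * S1 i j) + (\<Sum>i<k. \<Sum>j<k. of_bool (i < j) * S2 j i) =
        (\<Sum>i<k. \<Sum>j<k. of_bool (i < j) * (int (n - 2) + of_bool (a ! i < a ! j)))"
    proof -
      have "S1 i j + S2 j i = int (n - 2) + of_bool (a ! i < a ! j)" if "i < k" "j < k" for i j
        unfolding S1_def S2_def by (rule skip_col_inversions[OF n]; intro nth_words[OF a] that)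
      thus ?thesis unfolding sum.distrib[symmetric] distrib_left[symmetric]
        by (intro sum.cong refl) (simp only: lessThan_iff)
    qed
    also have "\<dots> = int (n - 2) * (\<Sum>i<k. \<Sum>j<k. of_bool (i < j)) +
        (\<Sum>i<k. \<Sum>j<k. of_bool (i < j) * of_bool (a ! i < a ! j))"
      unfolding sum_distrib_left sum.distrib[symmetric]
      by (intro sum.cong refl) (simp only: distrib_left mult.commute)
    finally show ?thesis unfolding sum_of_bool_less using sum_ascents[of a] by (simp only: len)
  qed
  also have "(\<Sum>i<k. \<Sum>r=1..n - 1. \<Sum>j<k. t (r, Suc i) (1, 2 * k - j)) =
      int (count (mset a) 1) * int (count (mset b) 1)"
  proof -
    have "(\<Sum>r=1..n - 1. \<Sum>j<k. t (r, Suc i) (1, 2 * k - j)) =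
        (\<Sum>j<k. of_bool (a ! i = 1) * of_bool (b ! j = 1))" if i: "i < k" for i
    proof -
      have "(\<Sum>j<k. t (r, Suc i) (1, 2 * k - j)) =
          (if r = 1 then (\<Sum>j<k. of_bool (a ! i = 1) * of_bool (b ! j = 1)) else 0)"
        if r: "r \<in> {1..n - 1}" for r
      proof -
        \<comment> \<open>Only row 1 matters. There the long column has the entry 2 if
          \<open>a ! i = 1\<close> and 1 otherwise, so it exceeds \<open>b ! j\<close> exactly if
          both letters are 1.\<close>
        have "t (r, Suc i) (1, 2 * k - j) =
            (if r = 1 then of_bool (a ! i = 1) * of_bool (b ! j = 1) else 0)" if "j < k" for j
          using nth_words[OF a i] nth_words[OF b that] i that
          unfolding t_def Flong[OF i r] Fshort[OF that]
          by (auto simp: Inv_attacks_def skip_col_def)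
        thus ?thesis by simp
      qed
      hence "(\<Sum>r=1..n - 1. \<Sum>j<k. t (r, Suc i) (1, 2 * k - j)) =
          (\<Sum>r=1..n - 1. if r = 1 then (\<Sum>j<k. of_bool (a ! i = 1) * of_bool (b ! j = 1)) else 0)"
        by (intro sum.cong refl)
      thus ?thesis using n by simp
    qed
    hence "(\<Sum>i<k. \<Sum>r=1..n - 1. \<Sum>j<k. t (r, Suc i) (1, 2 * k - j)) =
        (\<Sum>i<k. \<Sum>j<k. of_bool (a ! i = 1) * of_bool (b ! j = 1))"
      by (rule sum.cong[OF refl]) (simp only: lessThan_iff)
    also have "\<dots> = (\<Sum>i<k. of_bool (a ! i = 1)) * (\<Sum>j<k. of_bool (b ! j = 1))"
      by (rule sum_product[symmetric])
    also have "\<dots> = int (count (mset a) 1) * int (count (mset b) 1)"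
      using sum_of_bool_eq_1[of a 1] sum_of_bool_eq_1[of b 1] by (simp only: len)
    finally show ?thesis .
  qed
  \<comment> \<open>A single cell lies to the right of all long columns and has no row above
    it.\<close>
  also have "(\<Sum>i<k. \<Sum>j<k. \<Sum>r'=1..n - 1. t (1, 2 * k - i) (r', Suc j)) = 0"
    by (intro sum.neutral ballI) (auto simp: t_def Inv_attacks_def)
  also have "(\<Sum>i<k. \<Sum>j<k. t (1, 2 * k - i) (1, 2 * k - j)) = int (k choose 2) - int (weak_inv b)"
  proof -
    \<comment> \<open>As b is read from right to left, the cell of i is left of the cell of j
      exactly if j < i.\<close>
    have "(\<Sum>i<k. \<Sum>j<k. t (1, 2 * k - i) (1, 2 * k - j)) =
        (\<Sum>i<k. \<Sum>j<k. of_bool (j < i) * of_bool (b ! j < b ! i))"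
    proof (intro sum.cong refl)
      fix i j assume "i \<in> {..<k}" "j \<in> {..<k}"
      thus "t (1, 2 * k - i) (1, 2 * k - j) = of_bool (j < i) * of_bool (b ! j < b ! i)"
        unfolding t_def using Fshort[of i] Fshort[of j] by (auto simp: Inv_attacks_def)
    qed
    also have "\<dots> = (\<Sum>i<k. \<Sum>j<k. of_bool (i < j) * of_bool (b ! i < b ! j))" by (rule sum.swap)
    finally show ?thesis using sum_ascents[of b] by (simp only: len)
  qed
  finally show ?thesis unfolding F_def by (simp only: add_0_right)
qed

text \<open>By column strictness every cell below the first row is a descent, so the sum depends on
  the shape only: each of the rows 2 to n - 1 contributes k choose 2.\<close>

lemma sum_arm_Des_word_filling:
  assumes n: "n \<ge> 2" and a: "a \<in> words n k" and b: "b \<in> words n k"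
  shows "(\<Sum>u\<in>Des (k_theta n k) (word_filling n k (a, b)). int (arm (k_theta n k) u)) =
    int (n - 2) * int (k choose 2)"
proof -
  define F where "F = word_filling n k (a, b)"
  let ?dg = "dg (k_theta n k)"
  let ?arm = "arm (k_theta n k)"
  have strict: "F (r, c) < F (r', c)" if "(r, c) \<in> ?dg" "(r', c) \<in> ?dg" "r < r'" for r r' c
    using word_filling_col_strict[OF assms] that unfolding F_def by (auto simp: col_strict_fillings_def)
  have Des: "Des (k_theta n k) F = {u \<in> ?dg. fst u > 1}"
  proof -
    have "F (i - 1, j) < F (i, j)" if "(i, j) \<in> ?dg" "1 < i" for i j
      by (rule strict) (use that n in \<open>auto simp: dg_k_theta\<close>)
    thus ?thesis by (auto simp: Des_def)
  qed
  have arm: "?arm (r, Suc i) = k - Suc i" if "r \<in> {2..n - 1}" "i < k" for r i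
  proof -
    have "{c. (r, c) \<in> ?dg \<and> c > Suc i} = {Suc i<..k}" using that n by (auto simp: dg_k_theta)
    thus ?thesis by (simp add: arm_def)
  qed
  have "(\<Sum>u\<in>Des (k_theta n k) F. int (?arm u)) = (\<Sum>u\<in>?dg. if fst u > 1 then int (?arm u) else 0)"
    unfolding Des using finite_dg by (intro sum.mono_neutral_cong_left) auto
  also have "\<dots> = (\<Sum>i<k. \<Sum>r=1..n - 1. if r > 1 then int (?arm (r, Suc i)) else 0)"
    unfolding sum_dg_k_theta[OF n] by simp
  also have "\<dots> = (\<Sum>i<k. int (n - 2) * (\<Sum>j<k. of_bool (i < j)))"
  proof (rule sum.cong[OF refl])
    fix i assume "i \<in> {..<k}"
    hence i: "i < k" by simp
    have "(\<Sum>r=1..n - 1. if r > 1 then int (?arm (r, Suc i)) else 0) = (\<Sum>r=2..n - 1. int (k - Suc i))"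
      by (rule sum.mono_neutral_cong_right) (use arm i in auto)
    also have "\<dots> = int (n - 2) * int (k - Suc i)" using n by simp
    also have "int (k - Suc i) = (\<Sum>j<k. of_bool (i < j))"
    proof -
      have "{..<k} \<inter> {j. i < j} = {Suc i..<k}" by auto
      thus ?thesis by (simp add: of_bool_def sum.If_cases)
    qed
    finally show "(\<Sum>r=1..n - 1. if r > 1 then int (?arm (r, Suc i)) else 0) =
        int (n - 2) * (\<Sum>j<k. of_bool (i < j))" .
  qed
  also have "\<dots> = int (n - 2) * int (k choose 2)"
    unfolding sum_distrib_left[symmetric] sum_of_bool_less ..
  finally show ?thesis unfolding F_def .
qed

text \<open>The arms remove the terms with n - 2, and k^2 = k + 2 (k choose 2) absorbs the binomials
  of the two ascent counts.\<close>

lemma inv_stat_word_filling: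
  assumes "n \<ge> 2" "a \<in> words n k" "b \<in> words n k"
  shows "int k ^ 2 - inv_stat (k_theta n k) (word_filling n k (a, b)) = word_exp a b"
proof -
  have "int k ^ 2 = int k + 2 * int (k choose 2)"
    by (simp add: two_times_choose_two power2_eq_square)
  moreover have "length a = k" using assms(2) by (simp add: words_def)
  ultimately show ?thesis
    unfolding inv_stat_def card_Inv_set_word_filling[OF assms] sum_arm_Des_word_filling[OF assms] word_exp_def
    by simp
qed

section \<open>The weight of a filling\<close>

lemma x_pow_add: "x_pow (\<gamma> + \<delta>) = x_pow \<gamma> * x_pow \<delta>"
  by (simp add: x_pow_def mult_single)

lemma x_pow_sum: "x_pow (\<Sum>i\<in>A. f i) = (\<Prod>i\<in>A. x_pow (f i))"
proof (induction A rule: infinite_finite_induct)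
  case (insert x A)
  thus ?case by (simp add: x_pow_add)
qed (simp_all add: x_pow_def)

lemma sum_single_skip_col:
  assumes "n \<ge> 2" "a \<in> {1..n}"
  shows "(\<Sum>r=1..n - 1. Poly_Mapping.single (skip_col a r) (1::int)) =
           (\<Sum>j=1..n. Poly_Mapping.single j 1) - Poly_Mapping.single a 1"
proof -
  have "(\<Sum>r=1..n - 1. Poly_Mapping.single (skip_col a r) (1::int)) =
      (\<Sum>j\<in>{1..n} - {a}. Poly_Mapping.single j 1)"
    by (rule sum.reindex_bij_witness[where j = "skip_col a" and i = "\<lambda>j. if j < a then j else j - 1"])
      (use assms in \<open>auto simp: skip_col_def\<close>)
  also have "\<dots> = (\<Sum>j=1..n. Poly_Mapping.single j 1) - Poly_Mapping.single a 1"
    using assms(2) by (simp add: sum_diff1)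
  finally show ?thesis .
qed

lemma sum_single_nth: "(\<Sum>i<length w. Poly_Mapping.single (w ! i) 1) = mvec (mset w)"
  by (induction w) (simp_all add: mvec_def sum.lessThan_Suc_shift del: sum.lessThan_Suc)

text \<open>A long column omitting a has weight x_1 ... x_n / x_a, and the normalization removes the
  k factors x_1 ... x_n.\<close>

lemma x_bar_word_filling:
  assumes n: "n \<ge> 2" and a: "a \<in> words n k" and b: "b \<in> words n k"
  shows "x_bar n (k_theta n k) (word_filling n k (a, b)) = x_pow (mvec (mset b) - mvec (mset a))"
proof -
  let ?F = "word_filling n k (a, b)"
  let ?E = "\<Sum>j=1..n. Poly_Mapping.single j 1 :: expvec"
  have len: "length a = k" "length b = k" using a b by (simp_all add: words_def)
  have "sum_list (k_theta n k) = k * n"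
    using sum_list_theta[OF n] by (simp add: k_theta_def sum_list_const_mult)
  hence size: "sum_list (k_theta n k) div n = k" using n by simp
  have E: "(\<Sum>i<k. ?E) + (\<Sum>j=1..n. Poly_Mapping.single j (- int k)) = 0"
    by (rule poly_mapping_eqI) (simp only: lookup_add lookup_sum, simp add: lookup_single when_def)
  have "(\<Sum>u\<in>dg (k_theta n k). Poly_Mapping.single (?F u) (1::int)) =
      (\<Sum>i<k. \<Sum>r=1..n - 1. Poly_Mapping.single (skip_col (a ! i) r) 1) + (\<Sum>i<k. Poly_Mapping.single (b ! i) 1)"
    unfolding sum_dg_k_theta[OF n]
    by (intro arg_cong2[where f = "(+)"] sum.cong refl)
      (simp_all only: word_filling_long[OF n] word_filling_short[OF n] lessThan_iff)
  also have "(\<Sum>i<k. \<Sum>r=1..n - 1. Poly_Mapping.single (skip_col (a ! i) r) 1) =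
      (\<Sum>i<k. ?E - Poly_Mapping.single (a ! i) 1)"
    by (intro sum.cong refl sum_single_skip_col[OF n] nth_words[OF a]) simp
  also have "\<dots> + (\<Sum>i<k. Poly_Mapping.single (b ! i) 1) = (\<Sum>i<k. ?E) - mvec (mset a) + mvec (mset b)"
    using sum_single_nth[of a] sum_single_nth[of b] by (simp only: sum_subtractf len)
  finally have "(\<Sum>u\<in>dg (k_theta n k). Poly_Mapping.single (?F u) (1::int)) +
      (\<Sum>j=1..n. Poly_Mapping.single j (- int k)) = mvec (mset b) - mvec (mset a)"
    unfolding E[folded eq_neg_iff_add_eq_0] by (simp del: sum_negf)
  moreover have "x_filling (k_theta n k) ?F = x_pow (\<Sum>u\<in>dg (k_theta n k). Poly_Mapping.single (?F u) 1)"
    by (simp add: x_filling_def x_pow_sum x_var_def)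
  ultimately show ?thesis
    unfolding x_bar_def size by (simp only: x_pow_add[symmetric])
qed


subsection \<open>Telescoping\<close>

lemma fps_to_fls_sum: "fps_to_fls (\<Sum>x\<in>A. f x) = (\<Sum>x\<in>A. fps_to_fls (f x))"
  by (induction A rule: infinite_finite_induct) simp_all

lemma dist_fps_to_fls: "dist (fps_to_fls f) (fps_to_fls g) = dist f (g :: 'a::group_add fps)"
  by (auto simp: dist_fls_def dist_fps_def fls_subdegree_fls_to_fps dest: fps_to_fls_eq_imp_fps_eq
      simp flip: fps_to_fls_minus)

lemma tendsto_fps_to_fls:
  fixes f :: "'b \<Rightarrow> 'a::group_add fps"
  assumes "(f \<longlongrightarrow> g) F"
  shows "((\<lambda>x. fps_to_fls (f x)) \<longlongrightarrow> fps_to_fls g) F"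
  using assms by (simp add: tendsto_iff dist_fps_to_fls)

lemma word_series_tendsto_chi:
  assumes "n \<ge> 1"
  shows "word_series n \<longlonglongrightarrow> chi n"
proof (rule tendsto_fpsI)
  fix m
  \<comment> \<open>Coefficient m is settled by N = m + 1 and B = 2 N.\<close>
  have "fps_nth (word_series n k) m = fps_nth (chi n) m" if "n * (2 * Suc m) + Suc m \<le> k" for k
    using fps_cong_word_series[OF assms order_refl that] by (simp add: fps_cong_def)
  thus "\<forall>\<^sub>F k in sequentially. fps_nth (word_series n k) m = fps_nth (chi n) m"
    by (auto simp: eventually_sequentially)
qed

lemma bij_betw_word_filling_C_fillings:
  assumes "n \<ge> 2"
  shows "bij_betw (word_filling n k)
           {(a, b) \<in> words n k \<times> words n k. \<not> (k > 0 \<and> a ! 0 = 1 \<and> b ! 0 = 1)} (C_fillings n k)"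
proof -
  have "C_fillings n k \<subseteq> word_filling n k ` (words n k \<times> words n k)"
    using bij_betw_imp_surj_on[OF bij_betw_word_filling[OF assms]] by (auto simp: C_fillings_def)
  hence "C_fillings n k =
      word_filling n k ` {s \<in> words n k \<times> words n k. word_filling n k s \<in> C_fillings n k}"
    by (rule subset_imageE) auto
  also have "{s \<in> words n k \<times> words n k. word_filling n k s \<in> C_fillings n k} =
      {(a, b) \<in> words n k \<times> words n k. \<not> (k > 0 \<and> a ! 0 = 1 \<and> b ! 0 = 1)}"
    using word_filling_in_C_fillings_iff[OF assms] by auto
  finally have "C_fillings n k = word_filling n k `
      {(a, b) \<in> words n k \<times> words n k. \<not> (k > 0 \<and> a ! 0 = 1 \<and> b ! 0 = 1)}" .
  thus ?thesis
    by (intro bij_betw_subset[OF bij_betw_word_filling[OF assms]]) auto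
qed

definition word_term :: "nat list \<times> nat list \<Rightarrow> laurent_poly fps" where
  "word_term = (\<lambda>(a, b). fps_const (x_pow (mvec (mset b) - mvec (mset a))) * fps_X ^ nat (word_exp a b))"

lemma word_series_eq: "word_series n k = (\<Sum>s\<in>words n k \<times> words n k. word_term s)"
  by (simp add: word_series_def word_term_def sum.cartesian_product)

text \<open>The exponents are nonnegative by \<open>word_exp_nonneg\<close>, so each summand comes
  from a power series.\<close>

lemma sum_C_fillings:
  assumes n: "n \<ge> 2"
  shows "(\<Sum>F\<in>C_fillings n k. fls_const (x_bar n (k_theta n k) F) *
            fls_X_intpow (int k ^ 2 - inv_stat (k_theta n k) F)) =
    fps_to_fls (\<Sum>s | s \<in> words n k \<times> words n k \<and> \<not> (k > 0 \<and> fst s ! 0 = 1 \<and> snd s ! 0 = 1). word_term s)"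
proof -
  have set: "{(a, b) \<in> words n k \<times> words n k. \<not> (k > 0 \<and> a ! 0 = 1 \<and> b ! 0 = 1)} =
      {s. s \<in> words n k \<times> words n k \<and> \<not> (k > 0 \<and> fst s ! 0 = 1 \<and> snd s ! 0 = 1)}" by auto
  have "fls_const (x_bar n (k_theta n k) (word_filling n k (a, b))) *
      fls_X_intpow (int k ^ 2 - inv_stat (k_theta n k) (word_filling n k (a, b))) =
      fps_to_fls (word_term (a, b))" if ab: "a \<in> words n k" "b \<in> words n k" for a b
    using word_exp_nonneg[OF ab]
    by (simp add: inv_stat_word_filling[OF n ab] x_bar_word_filling[OF n ab] word_term_def
        fls_times_fps_to_fls fps_to_fls_power fls_X_power_conv_shift_1)
  thus ?thesis
    unfolding sum.reindex_bij_betw[OF bij_betw_word_filling_C_fillings[OF n], symmetric] set fps_to_fls_sum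
    by (intro sum.cong) auto
qed

lemma word_term_Cons_1:
  assumes "a \<in> words n k" "b \<in> words n k"
  shows "word_term (1 # a, 1 # b) = word_term (a, b)"
proof -
  have "word_exp (1 # a) (1 # b) = word_exp a b"
    by (rule word_exp_Cons_1) (use assms in \<open>auto simp: words_def\<close>)
  thus ?thesis
    unfolding word_term_def case_prod_conv mset.simps mvec_add_mset
    by (simp only: add_diff_cancel_left)
qed

text \<open>Dropping the first letters maps the pairs excluded at level k + 1 onto all pairs at
  level k, preserving terms by \<open>word_term_Cons_1\<close>.\<close>

lemma sum_word_term_Cons_1:
  assumes "n \<ge> 1"
  shows "(\<Sum>s | s \<in> words n (Suc k) \<times> words n (Suc k) \<and> fst s ! 0 = 1 \<and> snd s ! 0 = 1. word_term s) =
           word_series n k"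
  unfolding word_series_eq
proof (rule sum.reindex_bij_witness[where j = "\<lambda>(a, b). (tl a, tl b)" and i = "\<lambda>(a, b). (1 # a, 1 # b)"])
  fix s assume s: "s \<in> {s. s \<in> words n (Suc k) \<times> words n (Suc k) \<and> fst s ! 0 = 1 \<and> snd s ! 0 = 1}"
  obtain a b where ab: "s = (1 # a, 1 # b)" "a \<in> words n k" "b \<in> words n k"
    using s by (cases s; cases "fst s"; cases "snd s") (auto simp: words_def)
  show "(case case s of (a, b) \<Rightarrow> (tl a, tl b) of (a, b) \<Rightarrow> (1 # a, 1 # b)) = s"
    and "(case s of (a, b) \<Rightarrow> (tl a, tl b)) \<in> words n k \<times> words n k"
    and "word_term (case s of (a, b) \<Rightarrow> (tl a, tl b)) = word_term s"
    using ab word_term_Cons_1[OF ab(2,3)] by simp_all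
qed (use assms in \<open>auto simp: words_def\<close>)

text \<open>In the induction step the fillings of level m + 1 supply the pairs not both beginning
  with 1, and the remaining pairs are worth the previous partial sum. At level 0 no pair is
  excluded.\<close>

lemma partial_sum_C_fillings:
  assumes n: "n \<ge> 2"
  shows "(\<Sum>k<Suc m. \<Sum>F\<in>C_fillings n k. fls_const (x_bar n (k_theta n k) F) *
            fls_X_intpow (int k ^ 2 - inv_stat (k_theta n k) F)) = fps_to_fls (word_series n m)"
proof (induction m)
  case 0
  have "{s. s \<in> words n 0 \<times> words n 0 \<and> \<not> (0 < (0::nat) \<and> fst s ! 0 = 1 \<and> snd s ! 0 = 1)} =
      words n 0 \<times> words n 0" by auto
  thus ?case using sum_C_fillings[OF n, of 0] by (simp add: word_series_eq)
next
  case (Suc m)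
  let ?W = "words n (Suc m) \<times> words n (Suc m)"
  let ?P = "\<lambda>s. fst s ! 0 = 1 \<and> snd s ! 0 = (1::nat)"
  have "?W = {s. s \<in> ?W \<and> ?P s} \<union> {s. s \<in> ?W \<and> \<not> ?P s}" by blast
  hence "word_series n (Suc m) = (\<Sum>s\<in>{s. s \<in> ?W \<and> ?P s} \<union> {s. s \<in> ?W \<and> \<not> ?P s}. word_term s)"
    unfolding word_series_eq by simp
  also have "\<dots> = (\<Sum>s | s \<in> ?W \<and> ?P s. word_term s) + (\<Sum>s | s \<in> ?W \<and> \<not> ?P s. word_term s)"
    by (rule sum.union_disjoint) auto
  also have "(\<Sum>s | s \<in> ?W \<and> ?P s. word_term s) = word_series n m"
    using n by (intro sum_word_term_Cons_1) simp
  finally have "word_series n (Suc m) = word_series n m + (\<Sum>s | s \<in> ?W \<and> \<not> ?P s. word_term s)" .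
  thus ?case
    unfolding sum.lessThan_Suc[of _ "Suc m"] Suc.IH
    unfolding sum_C_fillings[OF n] by simp
qed

theorem corollary7:
  fixes n :: nat
  assumes "n \<ge> 2"
  shows "(\<lambda>k. \<Sum>F\<in>C_fillings n k.
            fls_const (x_bar n (k_theta n k) F) *
            fls_X_intpow (int k ^ 2 - inv_stat (k_theta n k) F))
         sums fps_to_fls (chi n)"
proof -
  have "(\<lambda>m. fps_to_fls (word_series n m)) \<longlonglongrightarrow> fps_to_fls (chi n)"
    using assms by (intro tendsto_fps_to_fls word_series_tendsto_chi) simp
  thus ?thesis
    unfolding sums_def partial_sum_C_fillings[OF assms, symmetric]
    \<comment> \<open>The partial sums were computed over \<open>k < Suc m\<close>, whence the shift
      of the index.\<close>
    by (rule LIMSEQ_imp_Suc)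
qed

end
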